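(* Let $G$ be a connected graph with minimum degree $\delta(G) \ge 3$. (1) If $G$ is a threshold graph, then $rx_3(G) \le 5$. (2) If $G$ is a chain graph, then $rx_3(G) \le 6$. (3) If $G$ is an interval graph, then $rx_3(G) \le \mathrm{diam}(G) + 4$; thus $\mathrm{diam}(G) \le rx_3(G) \le \mathrm{diam}(G)+4$. Moreover, all these upper bounds are tight: there exist a connected threshold graph $G$ with $\delta(G)\ge 3$ and $rx_3(G)=5$, a connected chain graph $G$ with $\delta(G)\ge 3$ and $rx_3(G)=6$, and a connected interval graph $G$ with $\delta(G)\ge 3$ and $rx_3(G)=\mathrm{diam}(G)+4$.
   Context: All graphs are undirected, finite and simple. An edge-coloring of a graph assigns a color to each edge; adjacent edges may receive the same color. A tree (subgraph) in an edge-colored graph is rainbow if no two of its edges have the same color. An edge-coloring of a connected graph $G$ is a 3-rainbow coloring if for every set $S$ of three vertices of $G$ there is a rainbow tree in $G$ whose vertex set contains $S$. The 3-rainbow index $rx_3(G)$ is the minimum number of colors in a 3-rainbow coloring of $G$. $\mathrm{diam}(G)$ is the maximum distance between two vertices of $G$. A graph $G$ is a threshold graph if there exist a weight function $w: V(G)\to\mathbb{R}$ and a real constant $t$ such that two (distinct) vertices $u,v$ are adjacent if and only if $w(u)+w(v)\ge t$. A bipartite graph $G$ with bipartition $(A,B)$ is a chain graph if the vertices of $A$ can be ordered as $(a_1,\dots,a_k)$ such that $N(a_1)\subseteq N(a_2)\subseteq\cdots\subseteq N(a_k)$, where $N(v)$ is the set of neighbors of $v$. An interval graph is an intersection graph of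 intervals on the real line: its vertices can be mapped to intervals so that two (distinct) vertices are adjacent if and only if the corresponding intervals have non-empty intersection. *)

theory Defs
  imports "HOL-Analysis.Analysis"
begin

text \<open>
  A graph is given by its vertex set \<open>V\<close> and its set \<open>E\<close> of edges, an edge being the
  two-element set of its ends.
\<close>

definition simple_graph :: "'a set \<Rightarrow> 'a set set \<Rightarrow> bool" where
  "simple_graph V E \<longleftrightarrow> finite V \<and> (\<forall>e\<in>E. e \<subseteq> V \<and> card e = 2)"

definition subgraph :: "'a set \<Rightarrow> 'a set set \<Rightarrow> 'a set \<Rightarrow> 'a set set \<Rightarrow> bool" where
  "subgraph W F V E \<longleftrightarrow> simple_graph W F \<and> W \<subseteq> V \<and> F \<subseteq> E"

definition neighbors :: "'a set set \<Rightarrow> 'a \<Rightarrow> 'a set" where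
  "neighbors E v = {u. {v, u} \<in> E}"

definition degree :: "'a set set \<Rightarrow> 'a \<Rightarrow> nat" where
  "degree E v = card (neighbors E v)"

text \<open>Meaningful only for finite nonempty \<open>V\<close>; the same holds for \<open>diam\<close> below.\<close>

definition min_degree :: "'a set \<Rightarrow> 'a set set \<Rightarrow> nat" where
  "min_degree V E = Min (degree E ` V)"

definition walk :: "'a set \<Rightarrow> 'a set set \<Rightarrow> 'a list \<Rightarrow> bool" where
  "walk V E p \<longleftrightarrow> p \<noteq> [] \<and> set p \<subseteq> V \<and> successively (\<lambda>u v. {u, v} \<in> E) p"

definition walk_between :: "'a set \<Rightarrow> 'a set set \<Rightarrow> 'a \<Rightarrow> 'a list \<Rightarrow> 'a \<Rightarrow> bool" where
  "walk_between V E u p v \<longleftrightarrow> walk V E p \<and> hd p = u \<and> last p = v"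

definition connected_graph :: "'a set \<Rightarrow> 'a set set \<Rightarrow> bool" where
  "connected_graph V E \<longleftrightarrow> V \<noteq> {} \<and> (\<forall>u\<in>V. \<forall>v\<in>V. \<exists>p. walk_between V E u p v)"

text \<open>The number of edges of a walk is one less than the length of its vertex list.\<close>

definition distance :: "'a set \<Rightarrow> 'a set set \<Rightarrow> 'a \<Rightarrow> 'a \<Rightarrow> nat" where
  "distance V E u v = (LEAST n. \<exists>p. walk_between V E u p v \<and> length p = Suc n)"

definition diam :: "'a set \<Rightarrow> 'a set set \<Rightarrow> nat" where
  "diam V E = Max {distance V E u v | u v. u \<in> V \<and> v \<in> V}"

text \<open>A cycle is listed without repeating its first vertex at the end.\<close>

definition is_cycle :: "'a set \<Rightarrow> 'a set set \<Rightarrow> 'a list \<Rightarrow> bool" where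
  "is_cycle V E p \<longleftrightarrow> walk V E p \<and> distinct p \<and> 3 \<le> length p \<and> {last p, hd p} \<in> E"

definition is_tree :: "'a set \<Rightarrow> 'a set set \<Rightarrow> bool" where
  "is_tree W F \<longleftrightarrow> simple_graph W F \<and> connected_graph W F \<and> \<not> (\<exists>p. is_cycle W F p)"

text \<open>
  Colors are natural numbers. A coloring is a total function on vertex sets, of which only the
  restriction to the edges matters.
\<close>

definition rainbow :: "('a set \<Rightarrow> nat) \<Rightarrow> 'a set set \<Rightarrow> bool" where
  "rainbow c F \<longleftrightarrow> inj_on c F"

definition three_rainbow_coloring :: "'a set \<Rightarrow> 'a set set \<Rightarrow> ('a set \<Rightarrow> nat) \<Rightarrow> bool" where
  "three_rainbow_coloring V E c \<longleftrightarrow>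
     (\<forall>S. S \<subseteq> V \<and> card S = 3 \<longrightarrow>
        (\<exists>W F. subgraph W F V E \<and> is_tree W F \<and> rainbow c F \<and> S \<subseteq> W))"

text \<open>
  The minimum exists for every connected graph: giving all edges different colors makes a spanning
  tree rainbow.
\<close>

definition rx3 :: "'a set \<Rightarrow> 'a set set \<Rightarrow> nat" where
  "rx3 V E = (LEAST k. \<exists>c. three_rainbow_coloring V E c \<and> card (c ` E) = k)"

definition threshold_graph :: "'a set \<Rightarrow> 'a set set \<Rightarrow> bool" where
  "threshold_graph V E \<longleftrightarrow>
     simple_graph V E \<and>
     (\<exists>(w :: 'a \<Rightarrow> real) t. \<forall>u\<in>V. \<forall>v\<in>V. u \<noteq> v \<longrightarrow> ({u, v} \<in> E \<longleftrightarrow> w u + w v \<ge> t))"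

definition bipartition :: "'a set \<Rightarrow> 'a set set \<Rightarrow> 'a set \<Rightarrow> 'a set \<Rightarrow> bool" where
  "bipartition V E A B \<longleftrightarrow>
     A \<union> B = V \<and> A \<inter> B = {} \<and> (\<forall>e\<in>E. \<exists>a\<in>A. \<exists>b\<in>B. e = {a, b})"

definition chain_graph :: "'a set \<Rightarrow> 'a set set \<Rightarrow> bool" where
  "chain_graph V E \<longleftrightarrow>
     simple_graph V E \<and>
     (\<exists>A B. bipartition V E A B \<and>
        (\<exists>as. distinct as \<and> set as = A \<and>
           sorted_wrt (\<lambda>a a'. neighbors E a \<subseteq> neighbors E a') as))"

text \<open>The intervals may be open, closed or half-open, and bounded or not.\<close>

definition interval_graph :: "'a set \<Rightarrow> 'a set set \<Rightarrow> bool" where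
  "interval_graph V E \<longleftrightarrow>
     simple_graph V E \<and>
     (\<exists>I :: 'a \<Rightarrow> real set.
        (\<forall>v\<in>V. is_interval (I v) \<and> I v \<noteq> {}) \<and>
        (\<forall>u\<in>V. \<forall>v\<in>V. u \<noteq> v \<longrightarrow> ({u, v} \<in> E \<longleftrightarrow> I u \<inter> I v \<noteq> {})))"

end

theory Submission
  imports Defs
begin

text \<open>
  A rainbow connected subgraph contains a rainbow tree, so for the upper bounds it suffices to
  connect any three vertices by edges of different colors. In each case there is a small core to
  which every other vertex can be joined by legs of each of three colors, so that three vertices
  can be joined to the core by legs of different colors. In a threshold graph the core is the
  triangle of the three heaviest vertices, in a chain graph the \<open>K\<^sub>3\<^sub>,\<^sub>3\<close> of the three vertices of
  highest degree on either side. In an interval graph it is the interior of a shortest path from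
  the interval that ends first to the interval that begins last. There, a vertex with fewer than
  three neighbors in the core borrows legs from neighbors outside the core; the vertices outside
  are split into three classes such that every closed neighborhood meets as many of them as its
  size permits, and the three additional colors belong to the pairs of classes.

  The bounds are attained by graphs with so many similar parts (three universal vertices with many
  leaves, \<open>K\<^sub>3\<^sub>,\<^sub>n\<close>, and a windmill of many copies of \<open>K\<^sub>4\<close>) that three of the parts are
  colored alike. A rainbow tree cannot use the same color in two of them.
\<close>

section \<open>Connectedness and spanning trees\<close>

text \<open>The bounds arise as follows. In a threshold or chain graph the legs take three colors. A
  triangle is spanned by two more edges, and in \<open>K\<^sub>3\<^sub>,\<^sub>3\<close> three legs
  always end in a star, which needs three more colors. In an interval graph a shortest path of
  length \<open>d\<close> has \<open>d - 2\<close> interior edges, each with its own color, and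
  three leg colors and three pair colors give \<open>d + 4\<close>; a core with the two ends of the
  path would cost two colors more. The obstacle in interval graphs is that a vertex off the path may
  have a single neighbor on it, so that degree three gives three legs only with the help of outside
  neighbors. One class for each leg color keeps this help cheap: edges between outside vertices need
  only three colors, and three legs can still be chosen without a clash. If the interval that begins
  last meets the one that ends first, the path has no interior; the graph is then complete and the
  threshold bound suffices. In the examples each part has \<open>k\<close> relevant edges, hence at
  most \<open>n ^ k\<close> color patterns with \<open>n\<close> colors, and more than
  \<open>2 * n ^ k\<close> parts force three equal patterns.\<close>

definition linked :: "'a set set \<Rightarrow> 'a \<Rightarrow> 'a \<Rightarrow> bool" where
  "linked F = (\<lambda>u v. {u, v} \<in> F)\<^sup>*\<^sup>*"

lemma linked_refl [simp]: "linked F u u"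
  by (simp add: linked_def)

lemma linked_edge: "{u, v} \<in> F \<Longrightarrow> linked F u v"
  by (simp add: linked_def r_into_rtranclp)

lemma linked_trans: "linked F u v \<Longrightarrow> linked F v w \<Longrightarrow> linked F u w"
  unfolding linked_def by (rule rtranclp_trans)

lemma linked_sym: "linked F u v \<Longrightarrow> linked F v u"
proof -
  have "symp (\<lambda>u v. {u, v} \<in> F)"
    by (simp add: symp_def insert_commute)
  then show "linked F u v \<Longrightarrow> linked F v u"
    unfolding linked_def by (metis symp_rtranclp sympD)
qed

lemma linked_mono: "linked F u v \<Longrightarrow> F \<subseteq> G \<Longrightarrow> linked G u v"
  unfolding linked_def by (erule rtranclp_mono[THEN predicate2D, rotated]) auto

text \<open>A path that leaves \<open>X\<close> has a first edge out of it. This edge extends a tree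
  that is not yet spanning, and in the lower bounds it is the edge by which a rainbow tree leaves a
  leaf or a blade.\<close>

lemma linked_cross:
  assumes "linked F u v" "u \<in> X" "v \<notin> X"
  shows "\<exists>a\<in>X. \<exists>b. b \<notin> X \<and> {a, b} \<in> F"
  using assms unfolding linked_def by (induction rule: rtranclp_induct) auto

lemma edgeD:
  assumes "simple_graph V E" "{u, v} \<in> E"
  shows "u \<in> V" "v \<in> V" "u \<noteq> v"
proof -
  have "{u, v} \<subseteq> V" "card {u, v} = 2"
    using assms unfolding simple_graph_def by auto
  then show "u \<in> V" "v \<in> V" "u \<noteq> v"
    by auto
qed

lemma edgeE:
  assumes "simple_graph V E" "e \<in> E"
  obtains u v where "e = {u, v}" "u \<noteq> v" "u \<in> V" "v \<in> V"
proof -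
  have "card e = 2" "e \<subseteq> V"
    using assms unfolding simple_graph_def by auto
  then show ?thesis
    using that by (auto simp: card_2_iff)
qed

lemma simple_graph_finite_edges:
  assumes "simple_graph V E"
  shows "finite E"
proof (rule finite_subset)
  show "E \<subseteq> Pow V" "finite (Pow V)"
    using assms by (auto simp: simple_graph_def)
qed

lemma simple_graph_subset: "simple_graph V E \<Longrightarrow> F \<subseteq> E \<Longrightarrow> simple_graph V F"
  by (auto simp: simple_graph_def)

lemma linked_in_vertices:
  assumes "linked E u v" "simple_graph V E" "u \<in> V"
  shows "v \<in> V"
  using assms(1,3) unfolding linked_def
  by (induction rule: rtranclp_induct) (auto dest: edgeD[OF assms(2)])

lemma neighbors_sym: "u \<in> neighbors E v \<longleftrightarrow> v \<in> neighbors E u"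
  by (simp add: neighbors_def insert_commute)

lemma neighbors_subset: "simple_graph V E \<Longrightarrow> neighbors E v \<subseteq> V"
  by (auto simp: neighbors_def dest: edgeD)

lemma finite_neighbors: "simple_graph V E \<Longrightarrow> finite (neighbors E v)"
  by (meson finite_subset neighbors_subset simple_graph_def)

lemma walk_between_snoc:
  assumes "walk_between V E u p v" "{v, w} \<in> E" "w \<in> V"
  shows "walk_between V E u (p @ [w]) w"
  using assms by (auto simp: walk_between_def walk_def successively_append_iff)

lemma walk_between_single: "u \<in> V \<Longrightarrow> walk_between V E u [u] u"
  by (simp add: walk_between_def walk_def)

lemma walk_between_mono:
  assumes "walk_between W F u p v" "W \<subseteq> V" "F \<subseteq> E"
  shows "walk_between V E u p v"
  using assms unfolding walk_between_def walk_def by (auto elim: successively_mono)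

lemma successively_linked:
  "successively (\<lambda>u v. {u, v} \<in> F) p \<Longrightarrow> p \<noteq> [] \<Longrightarrow> x \<in> set p \<Longrightarrow> linked F (hd p) x"
proof (induction p)
  case (Cons a p)
  show ?case
  proof (cases "x = a")
    case False
    then have "p \<noteq> []"
      using Cons.prems by auto
    then have "linked F (hd p) x"
      using Cons False by (auto simp: successively_Cons)
    moreover have "{a, hd p} \<in> F"
      using Cons.prems \<open>p \<noteq> []\<close> by (simp add: successively_Cons)
    ultimately show ?thesis
      by (metis linked_edge linked_trans list.sel(1))
  qed simp
qed simp

lemma walk_between_linked: "walk_between V E u p v \<Longrightarrow> linked E u v"
  unfolding walk_between_def walk_def by (metis last_in_set successively_linked)

lemma linked_walk:
  assumes "linked E u v" "simple_graph V E" "u \<in> V"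
  shows "\<exists>p. walk_between V E u p v"
  using assms(1,3) unfolding linked_def
proof (induction rule: rtranclp_induct)
  case base
  then show ?case
    by (intro exI[of _ "[u]"] walk_between_single)
next
  case (step y z)
  then show ?case
    by (metis assms(2) edgeD(2) walk_between_snoc)
qed

lemma connected_graph_iff:
  assumes "simple_graph V E"
  shows "connected_graph V E \<longleftrightarrow> V \<noteq> {} \<and> (\<forall>u\<in>V. \<forall>v\<in>V. linked E u v)"
  unfolding connected_graph_def using assms walk_between_linked linked_walk by metis

lemma connected_graph_rootI:
  assumes "simple_graph V E" "r \<in> V" "\<And>v. v \<in> V \<Longrightarrow> linked E r v"
  shows "connected_graph V E"
  unfolding connected_graph_iff[OF assms(1)] using assms linked_sym linked_trans by fastforce

text \<open>In a cycle through \<open>y\<close> both cyclic neighbors of \<open>y\<close> would be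
  \<open>u\<close>, its only neighbor, although a cycle lists at least three different vertices. As
  cycles are lists, \<open>y\<close> may stand inside, first or last.\<close>

lemma is_tree_add_leaf:
  assumes tree: "is_tree W F" and u: "u \<in> W" and y: "y \<notin> W"
  shows "is_tree (insert y W) (insert {u, y} F)"
proof -
  let ?F = "insert {u, y} F"
  have sW: "simple_graph W F" and cW: "connected_graph W F"
    and acyc: "\<And>p. \<not> is_cycle W F p"
    using tree by (auto simp: is_tree_def)
  have simple: "simple_graph (insert y W) ?F"
    using sW u y by (auto simp: simple_graph_def card_2_iff)
  have "linked ?F u v" if "v \<in> insert y W" for v
  proof (cases "v = y")
    case True
    then show ?thesis
      by (simp add: linked_edge)
  next
    case False
    then have "linked F u v"
      using that cW u by (auto simp: connected_graph_iff[OF sW])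
    then show ?thesis
      by (rule linked_mono) auto
  qed
  then have conn: "connected_graph (insert y W) ?F"
    using connected_graph_rootI[OF simple] u by blast
  have only: "v = u" if "{y, v} \<in> ?F \<or> {v, y} \<in> ?F" for v
    using that y edgeD[OF sW] by (auto simp: doubleton_eq_iff)
  have "\<not> is_cycle (insert y W) ?F p" for p
  proof
    assume "is_cycle (insert y W) ?F p"
    then have ne: "p \<noteq> []" and sub: "set p \<subseteq> insert y W"
      and suc: "successively (\<lambda>u v. {u, v} \<in> ?F) p"
      and dist: "distinct p" and len: "3 \<le> length p" and clos: "{last p, hd p} \<in> ?F"
      by (auto simp: is_cycle_def walk_def)
    show False
    proof (cases "y \<in> set p")
      case True
      then obtain xs ys where p: "p = xs @ y # ys"
        by (meson split_list)
      have a: "last xs = u" if "xs \<noteq> []"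
        using suc that only unfolding p by (auto simp: successively_append_iff)
      have b: "hd ys = u" if "ys \<noteq> []"
        using suc that only unfolding p by (auto simp: successively_append_iff successively_Cons)
      have c: "hd xs = u" if "ys = []" "xs \<noteq> []"
        using clos that only unfolding p by auto
      have d: "last ys = u" if "xs = []" "ys \<noteq> []"
        using clos that only unfolding p by auto
      consider "xs \<noteq> []" "ys \<noteq> []" | "xs = []" "ys \<noteq> []" | "ys = []" "xs \<noteq> []"
        using len p by fastforce
      then show False
      proof cases
        case 1
        then have "u \<in> set xs" "u \<in> set ys"
          using a b by (metis last_in_set, metis hd_in_set)
        then show False
          using dist p by auto
      next
        case 2
        obtain z zs where zs: "ys = z # zs"
          using 2 by (cases ys) auto
        moreover have "zs \<noteq> []"
          using 2 len p zs by auto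
        ultimately have "z = u" "u \<in> set zs"
          using b d 2 last_in_set[of zs] by auto
        then show False
          using dist p zs by auto
      next
        case 3
        obtain z zs where zs: "xs = z # zs"
          using 3 by (cases xs) auto
        moreover have "zs \<noteq> []"
          using 3 len p zs by auto
        ultimately have "z = u" "u \<in> set zs"
          using a c 3 last_in_set[of zs] by auto
        then show False
          using dist p zs by auto
      qed
    next
      case False
      then have sub': "set p \<subseteq> W"
        using sub by auto
      have "successively (\<lambda>u v. {u, v} \<in> F) p"
      proof (rule successively_mono[OF suc])
        fix a b
        assume "{a, b} \<in> ?F" "a \<in> set p" "b \<in> set p"
        then show "{a, b} \<in> F"
          using False by (auto simp: doubleton_eq_iff)
      qed
      moreover have "{last p, hd p} \<in> F"
      proof -
        have "last p \<noteq> y" "hd p \<noteq> y"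
          using False ne by (metis last_in_set, metis hd_in_set)
        then show ?thesis
          using clos by (auto simp: doubleton_eq_iff)
      qed
      ultimately have "is_cycle W F p"
        using ne sub' dist len by (simp add: is_cycle_def walk_def)
      then show False
        using acyc by blast
    qed
  qed
  then show ?thesis
    using simple conn by (simp add: is_tree_def)
qed

lemma is_tree_single: "is_tree {r} {}"
proof -
  have "\<not> is_cycle {r} {} p" for p
    by (auto simp: is_cycle_def walk_def)
  then show ?thesis
    using walk_between_single[of r "{r}" "{}"]
    by (auto simp: is_tree_def simple_graph_def connected_graph_def)
qed

text \<open>A maximal tree inside the component of \<open>r\<close> fills it, since an edge leaving
  the tree would add a leaf. The edge count serves the lower bounds on colors, the walks serve the
  comparison with the diameter.\<close>

lemma spanning_tree:
  assumes sg: "simple_graph V E" and r: "r \<in> V"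
  obtains T where "T \<subseteq> E" "is_tree {x. linked E r x} T" "card {x. linked E r x} = card T + 1"
    "\<And>x. linked E r x \<Longrightarrow> \<exists>p. walk_between {x. linked E r x} T r p x \<and> length p \<le> card T + 1"
proof -
  define R where "R = {x. linked E r x}"
  have RV: "R \<subseteq> V"
    using linked_in_vertices[OF _ sg r] by (auto simp: R_def)
  \<comment> \<open>The walk bound survives growth: the walk to a new leaf gains one vertex while
    the tree gains one edge.\<close>
  define good where "good X T \<longleftrightarrow> T \<subseteq> E \<and> r \<in> X \<and> is_tree X T \<and> card X = card T + 1 \<and>
    (\<forall>x\<in>X. \<exists>p. walk_between X T r p x \<and> length p \<le> card T + 1)" for X T
  define \<X> where "\<X> = {X. X \<subseteq> R \<and> (\<exists>T. good X T)}"
  have "good {r} {}"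
    using is_tree_single walk_between_single[of r "{r}"] by (fastforce simp: good_def)
  moreover have "r \<in> R"
    by (simp add: R_def)
  ultimately have "{r} \<in> \<X>"
    unfolding \<X>_def by blast
  have "finite \<X>"
  proof (rule finite_subset)
    show "\<X> \<subseteq> Pow V" "finite (Pow V)"
      using RV sg by (auto simp: \<X>_def simple_graph_def)
  qed
  then obtain X where X: "X \<in> \<X>" and max: "\<And>Y. Y \<in> \<X> \<Longrightarrow> X \<subseteq> Y \<Longrightarrow> X = Y"
    using finite_has_maximal[of \<X>] \<open>{r} \<in> \<X>\<close> by (metis empty_iff)
  then obtain T where XR: "X \<subseteq> R" and T: "good X T"
    unfolding \<X>_def by blast
  have TE: "T \<subseteq> E" and rX: "r \<in> X" and tree: "is_tree X T" and card: "card X = card T + 1"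
    and walks: "\<And>x. x \<in> X \<Longrightarrow> \<exists>p. walk_between X T r p x \<and> length p \<le> card T + 1"
    using T by (auto simp: good_def)
  have finT: "finite T"
    using TE simple_graph_finite_edges[OF sg] finite_subset by blast
  have finX: "finite X"
    using card by (metis add_is_0 card.infinite one_neq_zero)
  have "X = R"
  proof (rule ccontr)
    assume "X \<noteq> R"
    then obtain v where "v \<in> R" "v \<notin> X"
      using XR by blast
    then obtain a b where ab: "a \<in> X" "b \<notin> X" "{a, b} \<in> E"
      using linked_cross[of E r v X] rX by (auto simp: R_def)
    have "b \<in> R"
      using ab XR by (auto simp: R_def intro: linked_trans linked_edge)
    have notin: "{a, b} \<notin> T"
      using tree ab by (auto simp: is_tree_def simple_graph_def)
    have "\<exists>p. walk_between (insert b X) (insert {a, b} T) r p x \<and> length p \<le> card (insert {a, b} T) + 1"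
      if x: "x \<in> insert b X" for x
    proof (cases "x = b")
      case True
      obtain p where p: "walk_between X T r p a" "length p \<le> card T + 1"
        using walks ab by blast
      have "walk_between (insert b X) (insert {a, b} T) r p a"
        using walk_between_mono[OF p(1)] by blast
      then have "walk_between (insert b X) (insert {a, b} T) r (p @ [b]) b"
        by (rule walk_between_snoc) auto
      then show ?thesis
        using p(2) True notin finT by fastforce
    next
      case False
      then obtain p where p: "walk_between X T r p x" "length p \<le> card T + 1"
        using walks x by blast
      have "walk_between (insert b X) (insert {a, b} T) r p x"
        using walk_between_mono[OF p(1)] by blast
      then show ?thesis
        using p(2) notin finT by fastforce
    qed
    moreover have "is_tree (insert b X) (insert {a, b} T)"
      using tree ab by (simp add: is_tree_add_leaf)
    ultimately have "good (insert b X) (insert {a, b} T)"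
      using TE rX ab card notin finT finX by (auto simp: good_def)
    then have "insert b X \<in> \<X>"
      unfolding \<X>_def using XR \<open>b \<in> R\<close> by blast
    then show False
      using max ab(2) by blast
  qed
  then show ?thesis
    using that[OF TE] tree card walks unfolding R_def by blast
qed

section \<open>Rainbow colorings\<close>

text \<open>A rainbow connected subgraph may replace the rainbow tree, as it contains a spanning tree.\<close>

lemma three_rainbow_coloringI:
  assumes sg: "simple_graph V E"
    and ex: "\<And>x y z. x \<in> V \<Longrightarrow> y \<in> V \<Longrightarrow> z \<in> V \<Longrightarrow>
      \<exists>F r. F \<subseteq> E \<and> inj_on c F \<and> linked F r x \<and> linked F r y \<and> linked F r z"
  shows "three_rainbow_coloring V E c"
  unfolding three_rainbow_coloring_def
proof (intro allI impI)
  fix S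
  assume "S \<subseteq> V \<and> card S = 3"
  then obtain x y z where S: "S = {x, y, z}" and xyz: "x \<in> V" "y \<in> V" "z \<in> V"
    by (auto simp: card_3_iff)
  obtain F r where F: "F \<subseteq> E" "inj_on c F" and l: "linked F r x" "linked F r y" "linked F r z"
    using ex[OF xyz] by blast
  have sgF: "simple_graph V F"
    using sg F(1) by (rule simple_graph_subset)
  let ?W = "{w. linked F x w}"
  obtain T where T: "T \<subseteq> F" "is_tree ?W T"
    using spanning_tree[OF sgF xyz(1)] by metis
  have "subgraph ?W T V E"
    unfolding subgraph_def
    using T F(1) linked_in_vertices[OF _ sgF xyz(1)] by (auto simp: is_tree_def)
  moreover have "S \<subseteq> ?W"
    using l S by (auto intro: linked_trans linked_sym)
  moreover have "rainbow c T"
    using F(2) T(1) by (auto simp: rainbow_def intro: inj_on_subset)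
  ultimately show "\<exists>W F. subgraph W F V E \<and> is_tree W F \<and> rainbow c F \<and> S \<subseteq> W"
    using T(2) by blast
qed

lemma connected_card_le:
  assumes sg: "simple_graph W F" and "\<And>u v. u \<in> W \<Longrightarrow> v \<in> W \<Longrightarrow> linked F u v"
  shows "card W \<le> card F + 1"
proof (cases "W = {}")
  case False
  then obtain r where r: "r \<in> W"
    by blast
  then have "{x. linked F r x} = W"
    using assms linked_in_vertices[OF _ sg r] by blast
  moreover obtain T where "T \<subseteq> F" "card {x. linked F r x} = card T + 1"
    using spanning_tree[OF sg r] by metis
  ultimately show ?thesis
    using card_mono[OF simple_graph_finite_edges[OF sg], of T] by simp
qed simp

text \<open>The form used for lower bounds: connectedness forces edges out of given vertex sets, and
  every further vertex of \<open>W\<close> costs an edge and hence a color.\<close>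

lemma three_rainbow_coloringE:
  assumes "three_rainbow_coloring V E c" "x \<in> V" "y \<in> V" "z \<in> V" "x \<noteq> y" "x \<noteq> z" "y \<noteq> z"
  obtains W F where "simple_graph W F" "W \<subseteq> V" "F \<subseteq> E" "inj_on c F" "x \<in> W" "y \<in> W" "z \<in> W"
    "\<And>u v. u \<in> W \<Longrightarrow> v \<in> W \<Longrightarrow> linked F u v" "card W \<le> card F + 1"
proof -
  have "{x, y, z} \<subseteq> V \<and> card {x, y, z} = 3"
    using assms by simp
  then obtain W F where WF: "subgraph W F V E" "is_tree W F" "rainbow c F" "{x, y, z} \<subseteq> W"
    using assms(1) unfolding three_rainbow_coloring_def by meson
  have sg: "simple_graph W F"
    using WF by (simp add: is_tree_def)
  have "connected_graph W F"
    using WF by (simp add: is_tree_def)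
  then have l: "linked F u v" if "u \<in> W" "v \<in> W" for u v
    using that by (simp add: connected_graph_iff[OF sg])
  show ?thesis
    using that[of W F] WF sg l connected_card_le[OF sg l]
    by (auto simp: subgraph_def rainbow_def)
qed

lemma rx3_le:
  assumes "three_rainbow_coloring V E c" "card (c ` E) \<le> n"
  shows "rx3 V E \<le> n"
proof -
  have "rx3 V E \<le> card (c ` E)"
    unfolding rx3_def by (rule Least_le) (use assms in blast)
  then show ?thesis
    using assms by simp
qed

lemma three_rainbow_coloring_exists:
  assumes sg: "simple_graph V E" and conn: "connected_graph V E"
  shows "\<exists>c. three_rainbow_coloring V E c"
proof -
  obtain c :: "'a set \<Rightarrow> nat" where "inj_on c E"
    using finite_imp_inj_to_nat_seg[OF simple_graph_finite_edges[OF sg]] by metis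
  moreover have "linked E x y" if "x \<in> V" "y \<in> V" for x y
    using conn that by (simp add: connected_graph_iff[OF sg])
  ultimately have "three_rainbow_coloring V E c"
    by (intro three_rainbow_coloringI[OF sg]) blast
  then show ?thesis
    by blast
qed

lemma rx3_attained:
  assumes "simple_graph V E" "connected_graph V E"
  obtains c where "three_rainbow_coloring V E c" "card (c ` E) = rx3 V E"
proof -
  have "\<exists>k c. three_rainbow_coloring V E c \<and> card (c ` E) = k"
    using three_rainbow_coloring_exists[OF assms] by blast
  then have "\<exists>c. three_rainbow_coloring V E c \<and> card (c ` E) = rx3 V E"
    unfolding rx3_def by (rule LeastI_ex)
  then show ?thesis
    using that by blast
qed

section \<open>Minimum degree, distances and the diameter as a lower bound\<close>

lemma min_degreeD:
  assumes "simple_graph V E" "k \<le> min_degree V E" "v \<in> V"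
  shows "k \<le> card (neighbors E v)"
proof -
  have "min_degree V E \<le> degree E v"
    unfolding min_degree_def using assms by (auto simp: simple_graph_def intro!: Min_le)
  then show ?thesis
    using assms(2) by (simp add: degree_def)
qed

lemma min_degreeI:
  assumes "simple_graph V E" "V \<noteq> {}" "\<And>v. v \<in> V \<Longrightarrow> k \<le> card (neighbors E v)"
  shows "k \<le> min_degree V E"
  unfolding min_degree_def using assms by (auto simp: simple_graph_def degree_def intro!: Min.boundedI)

lemma distance_le_diam:
  assumes "simple_graph V E" "u \<in> V" "v \<in> V"
  shows "distance V E u v \<le> diam V E"
proof -
  have "{distance V E u v | u v. u \<in> V \<and> v \<in> V} = (\<lambda>(u, v). distance V E u v) ` (V \<times> V)"
    by auto
  then have "finite {distance V E u v | u v. u \<in> V \<and> v \<in> V}"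
    using assms(1) by (simp add: simple_graph_def)
  then show ?thesis
    unfolding diam_def using assms(2,3) by (intro Max_ge) auto
qed

lemma diam_attained:
  assumes "simple_graph V E" "V \<noteq> {}"
  obtains u v where "u \<in> V" "v \<in> V" "distance V E u v = diam V E"
proof -
  let ?D = "{distance V E u v | u v. u \<in> V \<and> v \<in> V}"
  have "?D = (\<lambda>(u, v). distance V E u v) ` (V \<times> V)"
    by auto
  then have "finite ?D"
    using assms(1) by (simp add: simple_graph_def)
  moreover have "?D \<noteq> {}"
    using assms(2) by auto
  ultimately have "diam V E \<in> ?D"
    unfolding diam_def by (rule Max_in)
  then show ?thesis
    using that by auto
qed

lemma distance_le:
  assumes "walk_between V E u p v" "length p \<le> Suc n"
  shows "distance V E u v \<le> n"
proof -
  have "length p = Suc (length p - 1)"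
    using assms by (cases p) (auto simp: walk_between_def walk_def)
  then have "distance V E u v \<le> length p - 1"
    unfolding distance_def by (intro Least_le) (use assms in blast)
  then show ?thesis
    using assms(2) by simp
qed

lemma distance_attained:
  assumes "connected_graph V E" "u \<in> V" "v \<in> V"
  obtains p where "walk_between V E u p v" "length p = Suc (distance V E u v)"
proof -
  obtain p where p: "walk_between V E u p v"
    using assms by (meson connected_graph_def)
  then have "length p = Suc (length p - 1)"
    by (cases p) (auto simp: walk_between_def walk_def)
  then have "\<exists>n p. walk_between V E u p v \<and> length p = Suc n"
    using p by blast
  then have "\<exists>p. walk_between V E u p v \<and> length p = Suc (distance V E u v)"
    unfolding distance_def by (rule LeastI_ex)
  then show ?thesis
    using that by blast
qed

lemma card_rainbow_le:
  assumes "simple_graph V E" "F \<subseteq> E" "inj_on c F"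
  shows "card F \<le> card (c ` E)"
  by (metis assms card_image card_mono finite_imageI image_mono simple_graph_finite_edges)

text \<open>A rainbow tree through two vertices at maximal distance contains a walk between them
  with at most as many edges as the tree, and the tree has at most as many edges as there are
  colors.\<close>

lemma diam_le_rx3:
  assumes sg: "simple_graph V E" and conn: "connected_graph V E" and deg: "3 \<le> min_degree V E"
  shows "diam V E \<le> rx3 V E"
proof -
  obtain u v where uv: "u \<in> V" "v \<in> V" "distance V E u v = diam V E"
    using diam_attained[OF sg] conn by (auto simp: connected_graph_def)
  show ?thesis
  proof (cases "u = v")
    case True
    then show ?thesis
      using uv distance_le[OF walk_between_single, of u V 0 E] by simp
  next
    case False
    \<comment> \<open>Colorings speak only of sets of three vertices; the degree bound supplies a
      third one.\<close>
    have "\<not> V \<subseteq> {u, v}"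
    proof
      assume "V \<subseteq> {u, v}"
      then have "card (neighbors E u) \<le> card {u, v}"
        using neighbors_subset[OF sg] by (meson card_mono finite.emptyI finite_insert order_trans)
      then show False
        using min_degreeD[OF sg deg uv(1)] False by simp
    qed
    then obtain w where w: "w \<in> V" "w \<noteq> u" "w \<noteq> v"
      by blast
    obtain c where c: "three_rainbow_coloring V E c" "card (c ` E) = rx3 V E"
      using rx3_attained[OF sg conn] .
    obtain W F where WF: "simple_graph W F" "W \<subseteq> V" "F \<subseteq> E" "inj_on c F" "u \<in> W" "v \<in> W"
      "\<And>u v. u \<in> W \<Longrightarrow> v \<in> W \<Longrightarrow> linked F u v"
      using three_rainbow_coloringE[OF c(1) uv(1,2) w(1) False] w by metis
    obtain T p where T: "T \<subseteq> F" "walk_between {x. linked F u x} T u p v" "length p \<le> card T + 1"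
      using spanning_tree[OF WF(1,5)] WF(5-7) by metis
    have "{x. linked F u x} \<subseteq> V"
      using linked_in_vertices[OF _ WF(1,5)] WF(2) by auto
    then have "walk_between V E u p v"
      using walk_between_mono[OF T(2)] T(1) WF(3) by auto
    then have "distance V E u v \<le> card T"
      using distance_le T(3) by fastforce
    also have "card T \<le> card (c ` E)"
      using card_rainbow_le[OF sg, of T c] T(1) WF(3,4) by (meson inj_on_subset order_trans)
    finally show ?thesis
      using c uv by simp
  qed
qed

text \<open>An edge determines its ends up to order, so the choice of an order is harmless for
  symmetric \<open>h\<close>. Colorings can thus be defined by the roles of the two ends.\<close>

lemma edge_coloring_of_symmetric:
  assumes "\<And>u v. h u v = h v u"
  obtains c :: "'a set \<Rightarrow> nat" where "\<And>u v. c {u, v} = h u v"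
proof
  fix u v
  let ?c = "\<lambda>e. SOME k. \<exists>u v. e = {u, v} \<and> k = h u v"
  have "\<exists>u' v'. {u, v} = {u', v'} \<and> ?c {u, v} = h u' v'"
    by (rule someI_ex) blast
  then show "?c {u, v} = h u v"
    using assms by (auto simp: doubleton_eq_iff)
qed

lemma card_colors_le:
  assumes "simple_graph V E" "\<And>u v. u \<in> V \<Longrightarrow> v \<in> V \<Longrightarrow> {u, v} \<in> E \<Longrightarrow> c {u, v} < n"
  shows "card (c ` E) \<le> n"
proof -
  have "c ` E \<subseteq> {..<n}"
    using assms(2) by (metis assms(1) edgeE image_subsetI lessThan_iff)
  then show ?thesis
    using card_mono[of "{..<n}" "c ` E"] by simp
qed

text \<open>The last step of every upper bound: \<open>P\<close> joins the attachment points
  \<open>p\<close>, \<open>q\<close>, \<open>r\<close> inside the core, and \<open>X\<close>,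
  \<open>Y\<close>, \<open>Z\<close> are the legs. Disjoint palettes keep the union rainbow. A leg
  may be empty, for a vertex of the core.\<close>

lemma rainbow_join:
  assumes P: "P \<subseteq> E" "inj_on c P" "c ` P \<subseteq> K" "linked P m p" "linked P m q" "linked P m r"
    and X: "X \<subseteq> E" "inj_on c X" "c ` X \<subseteq> I" "linked X p x"
    and Y: "Y \<subseteq> E" "inj_on c Y" "c ` Y \<subseteq> J" "linked Y q y"
    and Z: "Z \<subseteq> E" "inj_on c Z" "c ` Z \<subseteq> L" "linked Z r z"
    and disj: "K \<inter> (I \<union> J \<union> L) = {}" "I \<inter> (J \<union> L) = {}" "J \<inter> L = {}"
  shows "\<exists>F r. F \<subseteq> E \<and> inj_on c F \<and> linked F r x \<and> linked F r y \<and> linked F r z"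
proof -
  let ?F = "P \<union> (X \<union> (Y \<union> Z))"
  have inj_Un: "inj_on c (S \<union> T)" if "inj_on c S" "inj_on c T" "c ` S \<inter> c ` T = {}" for S T
    using that unfolding inj_on_Un by blast
  have YZ: "inj_on c (Y \<union> Z)"
    by (rule inj_Un[OF Y(2) Z(2)]) (use Y(3) Z(3) disj in blast)
  have XYZ: "inj_on c (X \<union> (Y \<union> Z))"
    by (rule inj_Un[OF X(2) YZ]) (use X(3) Y(3) Z(3) disj in blast)
  have "inj_on c ?F"
    by (rule inj_Un[OF P(2) XYZ]) (use P(3) X(3) Y(3) Z(3) disj in blast)
  moreover have "linked ?F m x" "linked ?F m y" "linked ?F m z"
    using linked_trans[of ?F m] linked_mono[of P _ _ ?F] linked_mono[of X _ _ ?F]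
      linked_mono[of Y _ _ ?F] linked_mono[of Z _ _ ?F] P(4-6) X(4) Y(4) Z(4) by blast+
  ultimately show ?thesis
    using P(1) X(1) Y(1) Z(1) by (intro exI[of _ ?F] exI[of _ m]) simp
qed

section \<open>Threshold graphs and chain graphs\<close>

lemma top_elements:
  fixes f :: "'a \<Rightarrow> 'b::linorder"
  assumes "finite X" "k \<le> card X"
  obtains D where "D \<subseteq> X" "card D = k" "\<And>u d. u \<in> X - D \<Longrightarrow> d \<in> D \<Longrightarrow> f u \<le> f d"
proof -
  have "\<exists>D\<subseteq>X. card D = k \<and> (\<forall>u\<in>X - D. \<forall>d\<in>D. f u \<le> f d)"
    using assms(2)
  proof (induction k)
    case 0
    then show ?case
      by (intro exI[of _ "{}"]) auto
  next
    case (Suc k)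
    then obtain D where D: "D \<subseteq> X" "card D = k" "\<forall>u\<in>X - D. \<forall>d\<in>D. f u \<le> f d"
      by auto
    have fin: "finite (X - D)" "finite D"
      using assms(1) D(1) finite_subset by auto
    have "X - D \<noteq> {}"
      using D(1,2) Suc.prems by auto
    then have "Max (f ` (X - D)) \<in> f ` (X - D)"
      using fin by simp
    then obtain d where d: "d \<in> X - D" "f d = Max (f ` (X - D))"
      by auto
    then have "\<forall>u\<in>X - D. f u \<le> f d"
      using fin by simp
    then show ?case
      using D d fin by (intro exI[of _ "insert d D"]) auto
  qed
  then show ?thesis
    using that by blast
qed

text \<open>If \<open>d\<close> were missing from \<open>N\<close>, then no element outside
  \<open>D\<close> could be in \<open>N\<close> either, as its value is at most \<open>f d\<close>;
  so \<open>N\<close> would fit into \<open>D - {d}\<close>. It is applied with \<open>N\<close> a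
  neighborhood, \<open>D\<close> the core and \<open>f\<close> the weight or the degree.\<close>

lemma top_elements_in_upper_set:
  fixes f :: "'a \<Rightarrow> 'b::linorder"
  assumes "finite D" "\<And>u d. u \<in> X - D \<Longrightarrow> d \<in> D \<Longrightarrow> f u \<le> f d"
    and "N \<subseteq> X" "card D \<le> card N" "d \<in> D" "\<And>u. u \<in> N \<Longrightarrow> f u \<le> f d \<Longrightarrow> d \<in> N"
  shows "d \<in> N"
proof (rule ccontr)
  assume d: "d \<notin> N"
  then have "N \<subseteq> D - {d}"
    using assms by blast
  then have "card N \<le> card (D - {d})"
    using assms(1) by (simp add: card_mono)
  then show False
    using assms(1,4,5) by (meson card_Diff1_less le_less_trans not_le)
qed

text \<open>The index of a core vertex will be the color of the legs that end there.\<close>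

lemma ex_three_indexing:
  assumes "card D = 3"
  obtains d :: "nat \<Rightarrow> 'a" and i where "D = {d 0, d 1, d 2}" "\<And>k. k < 3 \<Longrightarrow> d k \<in> D"
    "\<And>k. k < 3 \<Longrightarrow> i (d k) = k" "\<And>v. v \<in> D \<Longrightarrow> i v < (3::nat)" "\<And>v. v \<in> D \<Longrightarrow> d (i v) = v"
proof -
  have "finite D"
    using assms by (metis card.infinite zero_neq_numeral)
  then obtain d where bij: "bij_betw d {0..<3::nat} D"
    using ex_bij_betw_nat_finite[of D] assms by auto
  have "{0..<3} = {0, 1, 2::nat}"
    by auto
  then have "D = {d 0, d 1, d 2}"
    using bij by (auto simp: bij_betw_def)
  moreover have "d k \<in> D" "inv_into {0..<3} d (d k) = k" if "k < 3" for k
    using bij that by (auto simp: bij_betw_def)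
  moreover have "inv_into {0..<3} d v < 3" "d (inv_into {0..<3} d v) = v" if "v \<in> D" for v
    using bij that inv_into_into[of v d "{0..<3}"] by (auto simp: bij_betw_def f_inv_into_f)
  ultimately show ?thesis
    using that[of d "inv_into {0..<3} d"] by blast
qed

text \<open>Apart from the vertex itself, a neighborhood is closed under passing to heavier
  vertices. Having three elements, it contains the three heaviest vertices, unless its vertex is one
  of them.\<close>

lemma threshold_graph_core:
  assumes sg: "simple_graph V E" and deg: "3 \<le> min_degree V E" and ne: "V \<noteq> {}"
    and th: "threshold_graph V E"
  obtains D where "D \<subseteq> V" "card D = 3" "\<And>v d. v \<in> V \<Longrightarrow> d \<in> D \<Longrightarrow> v \<noteq> d \<Longrightarrow> {v, d} \<in> E"
proof -
  have finV: "finite V"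
    using sg by (simp add: simple_graph_def)
  obtain w :: "'a \<Rightarrow> real" and t where
    w: "\<And>u v. u \<in> V \<Longrightarrow> v \<in> V \<Longrightarrow> u \<noteq> v \<Longrightarrow> {u, v} \<in> E \<longleftrightarrow> w u + w v \<ge> t"
    using th unfolding threshold_graph_def by blast
  have cardN: "3 \<le> card (neighbors E v)" if "v \<in> V" for v
    using min_degreeD[OF sg deg that] .
  have N: "neighbors E v = {u \<in> V. u \<noteq> v \<and> w v + w u \<ge> t}" if "v \<in> V" for v
  proof -
    have "u \<in> neighbors E v \<longleftrightarrow> u \<in> V \<and> u \<noteq> v \<and> w v + w u \<ge> t" for u
      using w[OF that, of u] edgeD[OF sg, of v u] by (auto simp: neighbors_def)
    then show ?thesis
      by blast
  qed
  obtain v0 where v0: "v0 \<in> V"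
    using ne by blast
  have more: "3 < card V"
  proof -
    have "neighbors E v0 \<subset> V"
      using N v0 by auto
    then have "card (neighbors E v0) < card V"
      by (rule psubset_card_mono[OF finV])
    then show ?thesis
      using cardN[OF v0] by linarith
  qed
  obtain D where D: "D \<subseteq> V" "card D = 3" and top: "\<And>u d. u \<in> V - D \<Longrightarrow> d \<in> D \<Longrightarrow> w u \<le> w d"
    using top_elements[OF finV, of 3 w] more by auto
  have finD: "finite D"
    using D(1) finV finite_subset by blast
  have out: "{v, d} \<in> E" if "v \<in> V - D" "d \<in> D" for v d
  proof -
    have "d \<in> neighbors E v"
    proof (rule top_elements_in_upper_set[of D V w])
      show "neighbors E v \<subseteq> V"
        using sg by (rule neighbors_subset)
      show "card D \<le> card (neighbors E v)"
        using cardN that D(2) by auto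
      show "d \<in> neighbors E v" if "u \<in> neighbors E v" "w u \<le> w d" for u
        using that \<open>v \<in> V - D\<close> \<open>d \<in> D\<close> D(1) by (auto simp: N)
    qed (use finD top that in auto)
    then show ?thesis
      by (simp add: neighbors_def)
  qed
  \<comment> \<open>A fourth vertex shows that the core is a triangle: \<open>v\<close> is adjacent
    to \<open>d\<close>, and \<open>u\<close> is at least as heavy as \<open>v\<close>.\<close>
  obtain v where v: "v \<in> V - D"
    using more D by (metis DiffI finD card_mono not_le subsetI)
  have "{u, d} \<in> E" if "u \<in> D" "d \<in> D" "u \<noteq> d" for u d
  proof -
    have "v \<noteq> d" "v \<in> V" "u \<in> V" "d \<in> V"
      using v that D(1) by auto
    then show ?thesis
      using out[OF v that(2)] top[OF v that(1)] that(3) by (simp add: w)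
  qed
  then show ?thesis
    using that[OF D] out by blast
qed

lemma rx3_threshold_graph:
  assumes sg: "simple_graph V E" and "3 \<le> min_degree V E" "V \<noteq> {}" "threshold_graph V E"
  shows "rx3 V E \<le> 5"
proof -
  obtain D where D: "D \<subseteq> V" "card D = 3"
    and adj: "\<And>v d. v \<in> V \<Longrightarrow> d \<in> D \<Longrightarrow> v \<noteq> d \<Longrightarrow> {v, d} \<in> E"
    using threshold_graph_core[OF assms] by blast
  obtain d :: "nat \<Rightarrow> 'a" and i where Dd: "D = {d 0, d 1, d 2}"
    and d: "\<And>k. k < 3 \<Longrightarrow> d k \<in> D" and i: "\<And>k. k < 3 \<Longrightarrow> i (d k) = k"
    and il: "\<And>v. v \<in> D \<Longrightarrow> i v < (3::nat)" and di: "\<And>v. v \<in> D \<Longrightarrow> d (i v) = v"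
    using ex_three_indexing[OF D(2)] by blast
  \<comment> \<open>The triangle edges get \<open>2 + 0 + 1 = 3\<close>,
    \<open>2 + 0 + 2 = 4\<close>, and \<open>2 + 1 + 2 = 5\<close> cut down to 4. Only the first two
    are used, so this repetition does no harm; nor does the default 0 for edges outside the
    core.\<close>
  define h where "h u v = (if u \<in> D then if v \<in> D then min 4 (2 + i u + i v) else i u
    else if v \<in> D then i v else 0)" for u v
  obtain c where c: "\<And>u v. c {u, v} = h u v"
    by (rule edge_coloring_of_symmetric[of h]) (auto simp: h_def)
  let ?P = "{{d 0, d 1}, {d 0, d 2}}"
  have ne: "d 0 \<noteq> d 1" "d 0 \<noteq> d 2"
    using i[of 0] i[of 1] i[of 2] by auto
  have P: "?P \<subseteq> E"
    using adj[of "d 0" "d 1"] adj[of "d 0" "d 2"] d[of 0] d[of 1] d[of 2] D(1) ne by auto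
  have cP: "c {d 0, d 1} = 3" "c {d 0, d 2} = 4"
    using d[of 0] d[of 1] d[of 2] i[of 0] i[of 1] i[of 2] by (auto simp: c h_def)
  have lP: "linked ?P (d 0) v" if "v \<in> D" for v
    using that by (auto simp: Dd intro: linked_edge)
  have leg: "\<exists>p R. p \<in> D \<and> R \<subseteq> E \<and> inj_on c R \<and> c ` R \<subseteq> {j} \<and> linked R p x"
    if "x \<in> V" "j < 3" for x j
  proof (cases "x \<in> D")
    case True
    then show ?thesis
      by (intro exI[of _ x] exI[of _ "{}"]) auto
  next
    case False
    then have "c {d j, x} = j"
      using d i that by (simp add: c h_def)
    moreover have "{d j, x} \<in> E"
      using adj[of x "d j"] d that False by (auto simp: insert_commute)
    ultimately show ?thesis
      using d that by (intro exI[of _ "d j"] exI[of _ "{{d j, x}}"]) (auto intro: linked_edge)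
  qed
  have "three_rainbow_coloring V E c"
  proof (rule three_rainbow_coloringI[OF sg])
    fix x y z
    assume "x \<in> V" "y \<in> V" "z \<in> V"
    obtain p X where X: "p \<in> D" "X \<subseteq> E" "inj_on c X" "c ` X \<subseteq> {0}" "linked X p x"
      using leg[OF \<open>x \<in> V\<close>, of 0] by auto
    obtain q Y where Y: "q \<in> D" "Y \<subseteq> E" "inj_on c Y" "c ` Y \<subseteq> {1}" "linked Y q y"
      using leg[OF \<open>y \<in> V\<close>, of 1] by auto
    obtain r Z where Z: "r \<in> D" "Z \<subseteq> E" "inj_on c Z" "c ` Z \<subseteq> {2}" "linked Z r z"
      using leg[OF \<open>z \<in> V\<close>, of 2] by auto
    have "inj_on c ?P" "c ` ?P \<subseteq> {3, 4}"
      using cP by auto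
    from rainbow_join[OF P this lP[OF X(1)] lP[OF Y(1)] lP[OF Z(1)] X(2-5) Y(2-5) Z(2-5)]
    show "\<exists>F r. F \<subseteq> E \<and> inj_on c F \<and> linked F r x \<and> linked F r y \<and> linked F r z"
      by simp
  qed
  moreover have "card (c ` E) \<le> 5"
    by (rule card_colors_le[OF sg]) (use il in \<open>fastforce simp: c h_def\<close>)
  ultimately show ?thesis
    by (rule rx3_le)
qed

text \<open>Nested neighborhoods let the degree play the part of the weight of a threshold graph, on
  each side separately.\<close>

lemma chain_graph_core:
  assumes sg: "simple_graph V E" and deg: "3 \<le> min_degree V E" and ne: "V \<noteq> {}"
    and ch: "chain_graph V E"
  obtains A B A' B' where "A \<union> B = V" "A \<inter> B = {}" "A' \<subseteq> A" "B' \<subseteq> B" "card A' = 3" "card B' = 3"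
    "\<And>u v. {u, v} \<in> E \<Longrightarrow> u \<in> A \<longleftrightarrow> v \<in> B"
    "\<And>u v. u \<in> A' \<Longrightarrow> v \<in> B \<Longrightarrow> {u, v} \<in> E" "\<And>u v. u \<in> A \<Longrightarrow> v \<in> B' \<Longrightarrow> {u, v} \<in> E"
proof -
  have finV: "finite V"
    using sg by (simp add: simple_graph_def)
  obtain A B as where bip: "bipartition V E A B" and as: "distinct as" "set as = A"
    "sorted_wrt (\<lambda>a a'. neighbors E a \<subseteq> neighbors E a') as"
    using ch unfolding chain_graph_def by blast
  have AB: "A \<union> B = V" "A \<inter> B = {}" and ex: "\<And>e. e \<in> E \<Longrightarrow> \<exists>a\<in>A. \<exists>b\<in>B. e = {a, b}"
    using bip by (auto simp: bipartition_def)
  have edge: "u \<in> A \<longleftrightarrow> v \<in> B" if "{u, v} \<in> E" for u v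
    using ex[OF that] AB(2) by (auto simp: doubleton_eq_iff)
  have NA: "neighbors E a \<subseteq> B" if "a \<in> A" for a
    using that edge by (auto simp: neighbors_def)
  have NB: "neighbors E b \<subseteq> A" if "b \<in> B" for b
    using that edge by (auto simp: neighbors_def insert_commute)
  have chainA: "neighbors E a \<subseteq> neighbors E a' \<or> neighbors E a' \<subseteq> neighbors E a"
    if a: "a \<in> A" "a' \<in> A" for a a'
  proof -
    obtain i j where "i < length as" "j < length as" "a = as ! i" "a' = as ! j"
      using a as(2) by (metis in_set_conv_nth)
    then show ?thesis
      using as(3) by (cases i j rule: linorder_cases) (auto simp: sorted_wrt_iff_nth_less)
  qed
  \<comment> \<open>Nestedness passes to the other side: two incomparable neighborhoods in
    \<open>A\<close> contain \<open>a\<close> and \<open>a'\<close> whose own neighborhoods are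
    incomparable.\<close>
  have chainB: "neighbors E b \<subseteq> neighbors E b' \<or> neighbors E b' \<subseteq> neighbors E b"
    if b: "b \<in> B" "b' \<in> B" for b b'
  proof (rule ccontr)
    assume "\<not> ?thesis"
    then obtain a a' where a: "a \<in> neighbors E b" "a \<notin> neighbors E b'"
      "a' \<in> neighbors E b'" "a' \<notin> neighbors E b"
      by blast
    then have "a \<in> A" "a' \<in> A"
      using NB b by auto
    from chainA[OF this] show False
      using a by (metis neighbors_sym subsetD)
  qed
  have cardN: "3 \<le> card (neighbors E v)" if "v \<in> V" for v
    using min_degreeD[OF sg deg that] .
  have core: "\<exists>Y'\<subseteq>Y. card Y' = 3 \<and> (\<forall>x\<in>X. \<forall>y\<in>Y'. {x, y} \<in> E)"
    if XV: "X \<subseteq> V" and YV: "Y \<subseteq> V" and Xne: "X \<noteq> {}" and NX: "\<And>x. x \<in> X \<Longrightarrow> neighbors E x \<subseteq> Y"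
      and chain: "\<And>y y'. y \<in> Y \<Longrightarrow> y' \<in> Y \<Longrightarrow> neighbors E y \<subseteq> neighbors E y' \<or> neighbors E y' \<subseteq> neighbors E y"
    for X Y
  proof -
    have finY: "finite Y"
      using YV finV finite_subset by blast
    obtain x0 where "x0 \<in> X"
      using Xne by blast
    then have "3 \<le> card Y"
      using cardN[of x0] card_mono[OF finY NX] XV by fastforce
    then obtain Y' where Y': "Y' \<subseteq> Y" "card Y' = 3"
      and top: "\<And>u d. u \<in> Y - Y' \<Longrightarrow> d \<in> Y' \<Longrightarrow> degree E u \<le> degree E d"
      using top_elements[OF finY] by blast
    have "{x, y} \<in> E" if x: "x \<in> X" and y: "y \<in> Y'" for x y
    proof -
      have "y \<in> neighbors E x"
      proof (rule top_elements_in_upper_set[of Y' Y "degree E"])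
        show "finite Y'"
          using Y'(1) finY finite_subset by blast
        show "card Y' \<le> card (neighbors E x)"
          using cardN x XV Y'(2) by auto
        \<comment> \<open>Of two nested neighborhoods the one with fewer or equally many elements is
          contained in the other.\<close>
        show "y \<in> neighbors E x" if u: "u \<in> neighbors E x" "degree E u \<le> degree E y" for u
        proof -
          have "neighbors E u \<subseteq> neighbors E y"
            using chain[of u y] NX[OF x] u y Y'(1) card_seteq[OF finite_neighbors[OF sg]]
            unfolding degree_def by blast
          then show ?thesis
            using u(1) neighbors_sym by fast
        qed
      qed (use NX x y top in auto)
      then show ?thesis
        by (simp add: neighbors_def)
    qed
    then show ?thesis
      using Y' by blast
  qed
  obtain v where v: "v \<in> V"
    using ne by blast
  then obtain u where "u \<in> neighbors E v"
    using cardN[OF v] by fastforce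
  then have ne: "A \<noteq> {}" "B \<noteq> {}"
    using v AB(1) NA NB by auto
  have V: "A \<subseteq> V" "B \<subseteq> V"
    using AB by auto
  obtain B' where B': "B' \<subseteq> B" "card B' = 3" "\<forall>a\<in>A. \<forall>b\<in>B'. {a, b} \<in> E"
    using core[OF V ne(1) NA chainB] by blast
  obtain A' where A': "A' \<subseteq> A" "card A' = 3" "\<forall>b\<in>B. \<forall>a\<in>A'. {b, a} \<in> E"
    using core[OF V(2,1) ne(2) NB chainA] by blast
  have "{u, v} \<in> E" if "u \<in> A'" "v \<in> B" for u v
    using A'(3) that by (metis insert_commute)
  then show ?thesis
    using B'(3) by (intro that[OF AB A'(1) B'(1) A'(2) B'(2) edge]) auto
qed

text \<open>
  The edges of \<open>K\<^sub>3\<^sub>,\<^sub>3\<close> are colored by a Latin square, so that all stars are rainbow.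
\<close>

lemma latin_star:
  fixes a b :: "nat \<Rightarrow> 'a"
  assumes c: "\<And>i j. i < 3 \<Longrightarrow> j < 3 \<Longrightarrow> c {a i, b j} = 3 + (i + j) mod 3"
    and j: "j < 3" and U: "U \<subseteq> insert (b j) (a ` {..<3})"
  defines "P \<equiv> (\<lambda>u. {u, b j}) ` (U \<inter> a ` {..<3})"
  shows "inj_on c P" "c ` P \<subseteq> {3..<6}" "\<And>u. u \<in> U \<Longrightarrow> linked P (b j) u"
proof -
  show "inj_on c P"
  proof (rule inj_onI)
    fix e e'
    assume "e \<in> P" "e' \<in> P" "c e = c e'"
    then obtain i i' where i: "i < 3" "e = {a i, b j}" "i' < 3" "e' = {a i', b j}"
      by (auto simp: P_def)
    then have mod: "(i + j) mod 3 = (i' + j) mod 3"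
      using c \<open>c e = c e'\<close> j by simp
    have "k = 0 \<or> k = 1 \<or> k = 2" if "k < 3" for k :: nat
      using that by linarith
    from this[OF i(1)] this[OF i(3)] this[OF j] mod have "i = i'"
      by (elim disjE) simp_all
    then show "e = e'"
      using i by simp
  qed
  show "c ` P \<subseteq> {3..<6}"
    using c j by (auto simp: P_def)
  show "linked P (b j) u" if "u \<in> U" for u
  proof (cases "u \<in> a ` {..<3}")
    case True
    then show ?thesis
      using that by (auto simp: P_def intro: linked_sym[OF linked_edge])
  next
    case False
    then show ?thesis
      using that U by auto
  qed
qed

lemma rx3_chain_graph:
  assumes sg: "simple_graph V E" and "3 \<le> min_degree V E" "V \<noteq> {}" "chain_graph V E"
  shows "rx3 V E \<le> 6"
proof (rule chain_graph_core[OF assms])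
  fix A B A' B'
  assume AB: "A \<union> B = V" "A \<inter> B = {}" and sub: "A' \<subseteq> A" "B' \<subseteq> B"
    and card: "card A' = 3" "card B' = 3"
    and bip: "\<And>u v. {u, v} \<in> E \<Longrightarrow> u \<in> A \<longleftrightarrow> v \<in> B"
    and adj: "\<And>u v. u \<in> A' \<Longrightarrow> v \<in> B \<Longrightarrow> {u, v} \<in> E" "\<And>u v. u \<in> A \<Longrightarrow> v \<in> B' \<Longrightarrow> {u, v} \<in> E"
  obtain a :: "nat \<Rightarrow> 'a" and ia where A': "A' = {a 0, a 1, a 2}"
    and a: "\<And>k. k < 3 \<Longrightarrow> a k \<in> A'" and ia: "\<And>k. k < 3 \<Longrightarrow> ia (a k) = k"
    and ial: "\<And>v. v \<in> A' \<Longrightarrow> ia v < (3::nat)" and aia: "\<And>v. v \<in> A' \<Longrightarrow> a (ia v) = v"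
    using ex_three_indexing[OF card(1)] by blast
  obtain b :: "nat \<Rightarrow> 'a" and ib where B': "B' = {b 0, b 1, b 2}"
    and b: "\<And>k. k < 3 \<Longrightarrow> b k \<in> B'" and ib: "\<And>k. k < 3 \<Longrightarrow> ib (b k) = k"
    and ibl: "\<And>v. v \<in> B' \<Longrightarrow> ib v < (3::nat)" and bib: "\<And>v. v \<in> B' \<Longrightarrow> b (ib v) = v"
    using ex_three_indexing[OF card(2)] by blast
  define g where "g u v = (if u \<in> A' then if v \<in> B' then 3 + (ia u + ib v) mod 3 else ia u
    else if v \<in> B' then ib v else 0)" for u v
  define h where "h u v = (if u \<in> A \<and> v \<in> B then g u v else if v \<in> A \<and> u \<in> B then g v u else 0)" for u v
  obtain c where c: "\<And>u v. c {u, v} = h u v"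
    by (rule edge_coloring_of_symmetric[of h]) (use AB(2) in \<open>auto simp: h_def\<close>)
  have latin: "c {a i, b j} = 3 + (i + j) mod 3" if "i < 3" "j < 3" for i j
    using a[OF that(1)] b[OF that(2)] ia[OF that(1)] ib[OF that(2)] sub by (auto simp: c h_def g_def)
  have latin': "c {b i, a j} = 3 + (i + j) mod 3" if "i < 3" "j < 3" for i j
    using latin[OF that(2,1)] by (simp add: insert_commute add.commute)
  have imA: "a ` {..<3} = A'" and imB: "b ` {..<3} = B'"
    using a b ial aia ibl bib by (auto simp: image_iff) (metis lessThan_iff)+
  have leg: "\<exists>p R. p \<in> A' \<union> B' \<and> R \<subseteq> E \<and> inj_on c R \<and> c ` R \<subseteq> {j} \<and> linked R p x"
    if x: "x \<in> V" and j: "j < 3" for x j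
  proof -
    consider "x \<in> A' \<union> B'" | "x \<in> A" "x \<notin> A'" | "x \<in> B" "x \<notin> B'"
      using x AB(1) by blast
    then show ?thesis
    proof cases
      case 1
      then show ?thesis
        by (intro exI[of _ x] exI[of _ "{}"]) auto
    next
      case 2
      then have "c {x, b j} = j" "{x, b j} \<in> E"
        using b[OF j] ib[OF j] sub(2) adj(2) by (auto simp: c h_def g_def)
      then show ?thesis
        using b[OF j] by (intro exI[of _ "b j"] exI[of _ "{{x, b j}}"])
          (auto intro: linked_sym[OF linked_edge])
    next
      case 3
      then have "c {a j, x} = j" "{a j, x} \<in> E"
        using a[OF j] ia[OF j] sub(1) adj(1) by (auto simp: c h_def g_def)
      then show ?thesis
        using a[OF j] by (intro exI[of _ "a j"] exI[of _ "{{a j, x}}"]) (auto intro: linked_edge)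
    qed
  qed
  have core: "\<exists>P m. P \<subseteq> E \<and> inj_on c P \<and> c ` P \<subseteq> {3..<6} \<and> linked P m p \<and> linked P m q \<and> linked P m r"
    if "{p, q, r} \<subseteq> A' \<union> B'" for p q r
  proof -
    \<comment> \<open>At most one of three core vertices lies on one of the two sides; it can serve
      as the center of a star to the others. If that side contains none, any of its core vertices
      will do.\<close>
    have "(\<exists>j<3. {p, q, r} \<subseteq> insert (b j) A') \<or> (\<exists>j<3. {p, q, r} \<subseteq> insert (a j) B')"
    proof -
      have "\<exists>j<3. v = b j" if "v \<in> B'" for v
        using that ibl bib by metis
      moreover have "\<exists>j<3. v = a j" if "v \<in> A'" for v
        using that ial aia by metis
      moreover have "(0::nat) < 3"
        by simp
      ultimately show ?thesis
        using \<open>{p, q, r} \<subseteq> A' \<union> B'\<close> by (simp only: insert_subset Un_iff) blast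
    qed
    then show ?thesis
    proof (elim disjE exE conjE)
      fix j :: nat
      assume j: "j < 3" and U: "{p, q, r} \<subseteq> insert (b j) A'"
      have "(\<lambda>u. {u, b j}) ` ({p, q, r} \<inter> a ` {..<3}) \<subseteq> E"
        using adj(1) b[OF j] sub(2) by (auto simp: imA)
      then show ?thesis
        using latin_star[OF latin j U[folded imA]] by (metis insertCI)
    next
      fix j :: nat
      assume j: "j < 3" and U: "{p, q, r} \<subseteq> insert (a j) B'"
      have "{v, a j} \<in> E" if "v \<in> B'" for v
        using adj(2)[of "a j" v] a[OF j] sub(1) that by (auto simp: insert_commute)
      then have "(\<lambda>u. {u, a j}) ` ({p, q, r} \<inter> b ` {..<3}) \<subseteq> E"
        by (auto simp: imB)
      then show ?thesis
        using latin_star[OF latin' j U[folded imB]] by (metis insertCI)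
    qed
  qed
  have "three_rainbow_coloring V E c"
  proof (rule three_rainbow_coloringI[OF sg])
    fix x y z
    assume "x \<in> V" "y \<in> V" "z \<in> V"
    obtain p X where X: "p \<in> A' \<union> B'" "X \<subseteq> E" "inj_on c X" "c ` X \<subseteq> {0}" "linked X p x"
      using leg[OF \<open>x \<in> V\<close>, of 0] by auto
    obtain q Y where Y: "q \<in> A' \<union> B'" "Y \<subseteq> E" "inj_on c Y" "c ` Y \<subseteq> {1}" "linked Y q y"
      using leg[OF \<open>y \<in> V\<close>, of 1] by auto
    obtain r Z where Z: "r \<in> A' \<union> B'" "Z \<subseteq> E" "inj_on c Z" "c ` Z \<subseteq> {2}" "linked Z r z"
      using leg[OF \<open>z \<in> V\<close>, of 2] by auto
    obtain P m where P: "P \<subseteq> E" "inj_on c P" "c ` P \<subseteq> {3..<6}"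
      "linked P m p" "linked P m q" "linked P m r"
      using core[of p q r] X(1) Y(1) Z(1) by auto
    from rainbow_join[OF P X(2-5) Y(2-5) Z(2-5)]
    show "\<exists>F r. F \<subseteq> E \<and> inj_on c F \<and> linked F r x \<and> linked F r y \<and> linked F r z"
      by simp
  qed
  moreover have "card (c ` E) \<le> 6"
    by (rule card_colors_le[OF sg]) (use ial ibl in \<open>fastforce simp: c h_def g_def\<close>)
  ultimately show "rx3 V E \<le> 6"
    by (rule rx3_le)
qed

section \<open>Interval graphs\<close>

text \<open>
  The colors used to join a vertex of class \<open>a\<close> to the core by a leg of color \<open>j\<close>: for \<open>j \<noteq> a\<close> the
  leg may belong to a neighbor of class \<open>j\<close>, and then the edge to this neighbor has the color
  \<open>2 + j + a\<close> of the pair of classes.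
\<close>

definition leg_palette :: "nat \<Rightarrow> nat \<Rightarrow> nat set" where
  "leg_palette a j = insert j (if j = a then {} else {2 + j + a})"

text \<open>Different classes each take their own color and need no pair color. If two classes
  agree, one of the two vertices takes the third color together with one pair color. If all three
  agree on \<open>a\<close>, the colors 0, 1, 2 are used, and the pairs of \<open>a\<close> with the
  two other classes have different colors.\<close>

lemma disjoint_leg_palettes:
  assumes "a < 3" "b < 3" "c < 3"
  obtains i j k where "i < 3" "j < 3" "k < 3" "leg_palette a i \<inter> leg_palette b j = {}"
    "leg_palette a i \<inter> leg_palette c k = {}" "leg_palette b j \<inter> leg_palette c k = {}"
proof -
  have three: "n = 0 \<or> n = 1 \<or> n = 2" if "n < 3" for n :: nat
    using that by linarith
  have "\<exists>i<3. \<exists>j<3. \<exists>k<3. leg_palette a i \<inter> leg_palette b j = {} \<and>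
    leg_palette a i \<inter> leg_palette c k = {} \<and> leg_palette b j \<inter> leg_palette c k = {}"
    using three[OF assms(1)] three[OF assms(2)] three[OF assms(3)]
    by (elim disjE) (simp_all add: leg_palette_def numeral_3_eq_3 Ex_less_Suc)
  then show ?thesis
    using that by blast
qed

lemma leg_palette_less: "j < 3 \<Longrightarrow> a < 3 \<Longrightarrow> leg_palette a j \<subseteq> {..<6}"
  by (auto simp: leg_palette_def)

lemma ex_cover:
  assumes "finite B" "finite A" "A \<noteq> {}" "card A \<le> card B"
  obtains f where "f ` B \<subseteq> A" "A \<subseteq> f ` B"
proof -
  obtain g where g: "g ` A \<subseteq> B" "inj_on g A"
    using card_le_inj[OF assms(2,1,4)] by blast
  obtain a where a: "a \<in> A"
    using assms(3) by blast
  define f where "f b = (if b \<in> g ` A then inv_into A g b else a)" for b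
  have "f ` B \<subseteq> A"
    using a by (auto simp: f_def intro: inv_into_into)
  moreover have "x \<in> f ` B" if "x \<in> A" for x
  proof (rule image_eqI)
    show "x = f (g x)" "g x \<in> B"
      using that g by (auto simp: f_def)
  qed
  ultimately show ?thesis
    using that[of f] by blast
qed

text \<open>A vertex with few neighbors in \<open>D\<close> has many outside, hence many classes
  among them, and needs few colors on its own edges to \<open>D\<close>. The tree \<open>P\<close>
  uses \<open>card P\<close> colors of its own, apart from the six colors of the legs.\<close>

lemma rx3_dominating:
  fixes t :: "'a \<Rightarrow> nat"
  assumes sg: "simple_graph V E" and DV: "D \<subseteq> V"
    and PE: "P \<subseteq> E" and PD: "\<And>e. e \<in> P \<Longrightarrow> e \<subseteq> D" and lP: "\<And>d. d \<in> D \<Longrightarrow> linked P m d"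
    and dom: "\<And>v. v \<in> V - D \<Longrightarrow> neighbors E v \<inter> D \<noteq> {}"
    and deg: "\<And>v. v \<in> V - D \<Longrightarrow> 3 \<le> card (neighbors E v)"
    and t: "\<And>v. t v < 3"
    and tcard: "\<And>v. v \<in> V - D \<Longrightarrow>
      min 3 (card (insert v (neighbors E v - D))) \<le> card (t ` insert v (neighbors E v - D))"
  shows "rx3 V E \<le> card P + 6"
proof -
  \<comment> \<open>The leg colors that \<open>v\<close> must realize on its own core edges: its own
    class, so that others can borrow from it, and each class that no outside neighbor
    offers.\<close>
  define T where "T v = insert (t v) ({..<3} - t ` (neighbors E v - D))" for v
  have "\<exists>f. f ` (neighbors E v \<inter> D) \<subseteq> T v \<and> T v \<subseteq> f ` (neighbors E v \<inter> D)" if v: "v \<in> V - D" for v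
  proof -
    let ?N = "neighbors E v" and ?M = "insert v (neighbors E v - D)"
    have fin: "finite ?N"
      using finite_neighbors[OF sg] .
    have "v \<notin> ?N"
      using edgeD(3)[OF sg, of v v] by (auto simp: neighbors_def)
    then have M: "card ?M = Suc (card (?N - D))"
      using fin by simp
    have N: "card ?N = card (?N \<inter> D) + card (?N - D)"
      using card_Un_disjoint[of "?N \<inter> D" "?N - D"] fin by (simp add: Int_Diff_Un Int_Diff_disjoint)
    have "1 \<le> card (?N \<inter> D)"
      using dom[OF v] fin by (simp add: Suc_le_eq card_gt_0_iff)
    moreover have "card (T v) \<le> 4 - card (t ` ?M)"
    proof -
      have sub: "t ` ?M \<subseteq> {..<3}"
        using t by auto
      have "T v = insert (t v) ({..<3} - t ` ?M)"
        by (auto simp: T_def)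
      then have "card (T v) \<le> Suc (card ({..<3} - t ` ?M))"
        by (simp add: card_insert_le_m1 card_insert_if)
      also have "card ({..<3} - t ` ?M) = 3 - card (t ` ?M)"
        using sub by (subst card_Diff_subset) (auto intro: finite_subset)
      also have "card (t ` ?M) \<le> 3"
        using card_mono[OF _ sub] by simp
      then have "Suc (3 - card (t ` ?M)) = 4 - card (t ` ?M)"
        by simp
      finally show ?thesis .
    qed
    \<comment> \<open>If \<open>?M\<close> has \<open>s < 3\<close> elements, they show at least
      \<open>s\<close> classes, so \<open>card (T v) \<le> 4 - s\<close>, and at least
      \<open>3 - (s - 1)\<close> neighbors are in \<open>D\<close>. If \<open>s \<ge> 3\<close>, all
      classes occur and a single core neighbor suffices.\<close>
    ultimately have "card (T v) \<le> card (?N \<inter> D)"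
      using tcard[OF v] deg[OF v] unfolding M N by linarith
    moreover have "finite (T v)" "T v \<noteq> {}"
      by (auto simp: T_def)
    ultimately obtain f where "f ` (?N \<inter> D) \<subseteq> T v" "T v \<subseteq> f ` (?N \<inter> D)"
      using ex_cover[of "?N \<inter> D" "T v"] fin by auto
    then show ?thesis
      by blast
  qed
  then obtain f where f: "\<And>v. v \<in> V - D \<Longrightarrow> f v ` (neighbors E v \<inter> D) \<subseteq> T v"
    "\<And>v. v \<in> V - D \<Longrightarrow> T v \<subseteq> f v ` (neighbors E v \<inter> D)"
    by metis
  have Tl: "T v \<subseteq> {..<3}" for v
    using t by (auto simp: T_def)
  have finP: "finite P"
    using PE simple_graph_finite_edges[OF sg] finite_subset by blast
  obtain idx where idx: "bij_betw idx P {0..<card P}"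
    using ex_bij_betw_finite_nat[OF finP] by blast
  define h where "h u v = (if {u, v} \<in> P then 6 + idx {u, v}
    else if u \<in> D then if v \<in> D then 0 else f v u
    else if v \<in> D then f u v else min 5 (2 + t u + t v))" for u v
  obtain c where c: "\<And>u v. c {u, v} = h u v"
    by (rule edge_coloring_of_symmetric[of h]) (auto simp: h_def insert_commute)
  have cP: "c e = 6 + idx e" if "e \<in> P" for e
    using that PE by (metis (no_types, lifting) c edgeE h_def sg subsetD)
  have leg: "\<exists>p R. p \<in> D \<and> R \<subseteq> E \<and> inj_on c R \<and> c ` R \<subseteq> leg_palette (t x) j \<and> linked R p x"
    if x: "x \<in> V" and j: "j < 3" for x j
  proof -
    have direct: "\<exists>d\<in>D. {d, y} \<in> E \<and> c {d, y} = i" if y: "y \<in> V - D" and i: "i \<in> T y" for y i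
    proof -
      obtain d where d: "d \<in> neighbors E y" "d \<in> D" "f y d = i"
        using f(2)[OF y] i by blast
      have "{d, y} \<notin> P"
        using PD y by blast
      then have "c {d, y} = i"
        using d y by (simp add: c h_def)
      then show ?thesis
        using d by (auto simp: neighbors_def insert_commute)
    qed
    consider "x \<in> D" | "x \<in> V - D" "j \<in> T x" | "x \<in> V - D" "j \<notin> T x"
      using x by blast
    then show ?thesis
    proof cases
      case 1
      then show ?thesis
        by (intro exI[of _ x] exI[of _ "{}"]) auto
    next
      case 2
      then obtain d where "d \<in> D" "{d, x} \<in> E" "c {d, x} = j"
        using direct by blast
      then show ?thesis
        by (intro exI[of _ d] exI[of _ "{{d, x}}"]) (auto simp: leg_palette_def intro: linked_edge)
    next
      case 3
      \<comment> \<open>Some outside neighbor \<open>w\<close> has class \<open>j\<close>. As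
        \<open>T w\<close> contains the class of \<open>w\<close>, there is a core edge at
        \<open>w\<close> of color \<open>j\<close>, and the leg through \<open>w\<close> has exactly
        the colors in \<open>leg_palette (t x) j\<close>.\<close>
      then have "j \<in> t ` (neighbors E x - D)" and jx: "j \<noteq> t x"
        using j by (auto simp: T_def)
      then obtain w where w: "{w, x} \<in> E" "w \<notin> D" "t w = j"
        by (auto simp: neighbors_def insert_commute)
      then have wV: "w \<in> V - D"
        using edgeD[OF sg] by blast
      have "j \<in> T w"
        using w(3) by (simp add: T_def)
      then obtain d where d: "d \<in> D" "{d, w} \<in> E" "c {d, w} = j"
        using direct[OF wV] by blast
      have "{w, x} \<notin> P"
        using PD w(2) by blast
      then have "c {w, x} = min 5 (2 + j + t x)"
        using w 3 by (simp add: c h_def)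
      moreover have "j + t x \<le> 3" "0 < j + t x"
        using j jx t[of x] by linarith+
      ultimately have cwx: "c {w, x} = 2 + j + t x" "2 + j + t x \<noteq> j"
        by auto
      have "linked {{d, w}, {w, x}} d x"
        by (rule linked_trans[of _ d w]) (auto intro: linked_edge)
      then show ?thesis
        using d w(1) cwx jx
        by (intro exI[of _ d] exI[of _ "{{d, w}, {w, x}}"]) (auto simp: leg_palette_def)
    qed
  qed
  have injP: "inj_on c P"
    using idx cP by (auto simp: inj_on_def bij_betw_def)
  have colP: "c ` P \<subseteq> {6..}"
    using cP by auto
  have "three_rainbow_coloring V E c"
  proof (rule three_rainbow_coloringI[OF sg])
    fix x y z
    assume V: "x \<in> V" "y \<in> V" "z \<in> V"
    obtain i j k where ijk: "i < 3" "j < 3" "k < 3"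
      and disj: "leg_palette (t x) i \<inter> leg_palette (t y) j = {}"
        "leg_palette (t x) i \<inter> leg_palette (t z) k = {}" "leg_palette (t y) j \<inter> leg_palette (t z) k = {}"
      using disjoint_leg_palettes[OF t t t] by metis
    obtain p X where X: "p \<in> D" "X \<subseteq> E" "inj_on c X" "c ` X \<subseteq> leg_palette (t x) i" "linked X p x"
      using leg[OF V(1) ijk(1)] by blast
    obtain q Y where Y: "q \<in> D" "Y \<subseteq> E" "inj_on c Y" "c ` Y \<subseteq> leg_palette (t y) j" "linked Y q y"
      using leg[OF V(2) ijk(2)] by blast
    obtain r Z where Z: "r \<in> D" "Z \<subseteq> E" "inj_on c Z" "c ` Z \<subseteq> leg_palette (t z) k" "linked Z r z"
      using leg[OF V(3) ijk(3)] by blast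
    have "{6..} \<inter> (leg_palette (t x) i \<union> leg_palette (t y) j \<union> leg_palette (t z) k) = {}"
      using leg_palette_less[OF ijk(1) t, of x] leg_palette_less[OF ijk(2) t, of y]
        leg_palette_less[OF ijk(3) t, of z] by fastforce
    moreover have "leg_palette (t x) i \<inter> (leg_palette (t y) j \<union> leg_palette (t z) k) = {}"
      using disj by blast
    ultimately show "\<exists>F r. F \<subseteq> E \<and> inj_on c F \<and> linked F r x \<and> linked F r y \<and> linked F r z"
      by (rule rainbow_join[OF PE injP colP lP[OF X(1)] lP[OF Y(1)] lP[OF Z(1)] X(2-5) Y(2-5) Z(2-5)
            _ _ disj(3)])
  qed
  moreover have "card (c ` E) \<le> card P + 6"
  proof (rule card_colors_le[OF sg])
    fix u v
    assume uv: "u \<in> V" "v \<in> V" "{u, v} \<in> E"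
    have fl: "f y d < 3" if "{d, y} \<in> E" "d \<in> D" "y \<in> V - D" for y d
    proof -
      have "d \<in> neighbors E y \<inter> D"
        using that by (simp add: neighbors_def insert_commute)
      then have "f y d \<in> T y"
        using f(1)[OF that(3)] by blast
      then show ?thesis
        using Tl by blast
    qed
    have "idx e < card P" if "e \<in> P" for e
      using idx that by (auto simp: bij_betw_def)
    moreover have "f u v < 3" if "v \<in> D" "u \<notin> D"
      using fl[of v u] uv that by (simp add: insert_commute)
    moreover have "f v u < 3" if "u \<in> D" "v \<notin> D"
      using fl[of u v] uv that by simp
    ultimately show "c {u, v} < card P + 6"
      by (auto simp: c h_def)
  qed
  ultimately show ?thesis
    by (rule rx3_le)
qed

text \<open>Open or unbounded intervals have no usable ends. Choosing a point in each nonempty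
  intersection and shrinking every interval to the hull of its finitely many chosen points keeps all
  intersections and creates none.\<close>

lemma interval_graph_real_endpoints:
  assumes "interval_graph V E"
  obtains l r :: "'a \<Rightarrow> real" where "\<And>v. v \<in> V \<Longrightarrow> l v \<le> r v"
    "\<And>u v. u \<in> V \<Longrightarrow> v \<in> V \<Longrightarrow> u \<noteq> v \<Longrightarrow> {u, v} \<in> E \<longleftrightarrow> l u \<le> r v \<and> l v \<le> r u"
proof -
  have finV: "finite V"
    using assms by (simp add: interval_graph_def simple_graph_def)
  obtain I :: "'a \<Rightarrow> real set" where I0: "\<forall>v\<in>V. is_interval (I v) \<and> I v \<noteq> {}"
    and adj: "\<forall>u\<in>V. \<forall>v\<in>V. u \<noteq> v \<longrightarrow> ({u, v} \<in> E \<longleftrightarrow> I u \<inter> I v \<noteq> {})"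
    using assms unfolding interval_graph_def by (elim conjE exE)
  have I: "is_interval (I v)" "I v \<noteq> {}" if "v \<in> V" for v
    using I0 that by auto
  define q :: "real set \<Rightarrow> real" where "q S = (SOME x. x \<in> S)" for S
  have q: "q S \<in> S" if "S \<noteq> {}" for S
    unfolding q_def using that by (simp add: some_in_eq)
  \<comment> \<open>The case \<open>v = u\<close> is included, so that \<open>Q u\<close> is
    nonempty even for an isolated vertex.\<close>
  define Q where "Q u = (\<lambda>v. q (I u \<inter> I v)) ` {v \<in> V. I u \<inter> I v \<noteq> {}}" for u
  have Qfin: "finite (Q u)" for u
    using finV by (simp add: Q_def)
  have Qne: "Q u \<noteq> {}" if "u \<in> V" for u
    using that I(2)[OF that] by (auto simp: Q_def)
  have "q (I u \<inter> I v) \<in> I u" if "I u \<inter> I v \<noteq> {}" for u v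
    using q[OF that] by simp
  then have QI: "Q u \<subseteq> I u" for u
    by (auto simp: Q_def)
  have ends: "Min (Q u) \<in> I u" "Max (Q u) \<in> I u" "Min (Q u) \<le> Max (Q u)" if "u \<in> V" for u
  proof -
    have "Min (Q u) \<in> Q u" "Max (Q u) \<in> Q u"
      using Min_in[OF Qfin Qne[OF that]] Max_in[OF Qfin Qne[OF that]] by blast+
    then show "Min (Q u) \<in> I u" "Max (Q u) \<in> I u" "Min (Q u) \<le> Max (Q u)"
      using QI Min_le[OF Qfin] by blast+
  qed
  have "I u \<inter> I v \<noteq> {} \<longleftrightarrow> Min (Q u) \<le> Max (Q v) \<and> Min (Q v) \<le> Max (Q u)"
    if uv: "u \<in> V" "v \<in> V" for u v
  proof
    assume "I u \<inter> I v \<noteq> {}"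
    then have "q (I u \<inter> I v) \<in> Q u" "q (I v \<inter> I u) \<in> Q v"
      using uv unfolding Q_def by blast+
    then have "Min (Q u) \<le> q (I u \<inter> I v)" "q (I u \<inter> I v) \<le> Max (Q u)"
      "Min (Q v) \<le> q (I v \<inter> I u)" "q (I v \<inter> I u) \<le> Max (Q v)"
      using Min_le[OF Qfin] Max_ge[OF Qfin] by blast+
    then show "Min (Q u) \<le> Max (Q v) \<and> Min (Q v) \<le> Max (Q u)"
      unfolding Int_commute[of "I v" "I u"] by linarith
  next
    assume le: "Min (Q u) \<le> Max (Q v) \<and> Min (Q v) \<le> Max (Q u)"
    \<comment> \<open>The larger of the two left ends lies in both hulls, hence in both original
      intervals.\<close>
    let ?x = "max (Min (Q u)) (Min (Q v))"
    have "?x \<in> I u"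
      by (rule mem_is_interval_1_I[OF I(1) ends(1,2)]) (use uv ends(3)[OF uv(1)] le in simp_all)
    moreover have "?x \<in> I v"
      by (rule mem_is_interval_1_I[OF I(1) ends(1,2)]) (use uv ends(3)[OF uv(2)] le in simp_all)
    ultimately show "I u \<inter> I v \<noteq> {}"
      by blast
  qed
  then show ?thesis
    using adj by (intro that[of "\<lambda>u. Min (Q u)" "\<lambda>u. Max (Q u)"] ends(3)) simp_all
qed

text \<open>
  The vertices are classified in the order of their left ends. Each joins a class that reaches
  least far to the right, hence completes the classes among the intervals that end after any
  given point \<open>x\<close>.
\<close>

lemma interval_three_classes:
  fixes l r :: "'a \<Rightarrow> real"
  assumes "finite H"
  shows "\<exists>t :: 'a \<Rightarrow> nat. (\<forall>v. t v < 3) \<and> (\<forall>x y. min 3 (card {u \<in> H. l u \<le> y \<and> x \<le> r u})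
    \<le> card (t ` {u \<in> H. l u \<le> y \<and> x \<le> r u}))"
  using assms
proof (induction rule: finite_ranking_induct[where f = l])
  case empty
  then show ?case
    by (intro exI[of _ "\<lambda>_. 0"]) simp
next
  case (insert v S)
  then obtain t where t: "\<And>v. t v < (3::nat)" and tc: "\<And>x y. min 3 (card {u \<in> S. l u \<le> y \<and> x \<le> r u})
    \<le> card (t ` {u \<in> S. l u \<le> y \<and> x \<le> r u})"
    by blast
  have le: "l u \<le> l v" if "u \<in> S" for u
    using insert that by blast
  show ?case
  proof (cases "v \<in> S")
    case True
    then show ?thesis
      using t tc by (auto simp: insert_absorb)
  next
    case False
    define R where "R x = t ` {u \<in> S. x \<le> r u}" for x
    obtain k where k: "k < 3" and kR: "\<And>x. k \<in> R x \<Longrightarrow> {..<3} \<subseteq> R x"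
    proof (cases "{..<3} \<subseteq> t ` S")
      case False
      then obtain k where "k < 3" "k \<notin> t ` S"
        by auto
      then show ?thesis
        using that[of k] by (auto simp: R_def)
    next
      case True
      \<comment> \<open>The farthest right end within class \<open>i\<close>. If the class with the
        smallest such value reaches \<open>x\<close>, so does every class.\<close>
      define m where "m i = Max (r ` {u \<in> S. t u = i})" for i
      have m: "m i \<in> r ` {u \<in> S. t u = i}" if "i < 3" for i
        unfolding m_def using that True insert(1) by (intro Max_in) auto
      have m_ge: "r u \<le> m (t u)" if "u \<in> S" for u
        unfolding m_def using that insert(1) by (intro Max_ge) auto
      have "Min (m ` {..<3}) \<in> m ` {..<3::nat}"
        by (rule Min_in) (auto simp: lessThan_empty_iff)
      then obtain k where k: "k < 3" "m k = Min (m ` {..<3})"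
        by auto
      then have min: "m k \<le> m i" if "i < 3" for i
        using that by simp
      have "{..<3} \<subseteq> R x" if "k \<in> R x" for x
      proof
        fix i :: nat
        assume "i \<in> {..<3}"
        then obtain u where "u \<in> S" "t u = i" "r u = m i"
          using m[of i] by auto
        moreover have "x \<le> m k"
          using that m_ge by (force simp: R_def)
        ultimately show "i \<in> R x"
          using min[of i] \<open>i \<in> {..<3}\<close> by (force simp: R_def)
      qed
      then show ?thesis
        using that k(1) by blast
    qed
    have "min 3 (card {u \<in> insert v S. l u \<le> y \<and> x \<le> r u})
      \<le> card ((t(v := k)) ` {u \<in> insert v S. l u \<le> y \<and> x \<le> r u})" for x y
    proof (cases "l v \<le> y \<and> x \<le> r v")
      case True
      let ?A = "{u \<in> S. l u \<le> y \<and> x \<le> r u}"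
      \<comment> \<open>No earlier interval has a larger left end than \<open>v\<close>, so the
        bound \<open>y\<close> excludes none of them once it admits \<open>v\<close>.\<close>
      have A: "?A = {u \<in> S. x \<le> r u}"
        using True le by fastforce
      have A': "{u \<in> insert v S. l u \<le> y \<and> x \<le> r u} = insert v ?A"
        using True by auto
      have im: "(t(v := k)) ` insert v ?A = insert k (R x)"
        using False by (auto simp: R_def A)
      have fin: "finite ?A" "finite (R x)"
        using insert(1) by (auto simp: R_def)
      show ?thesis
      proof (cases "k \<in> R x")
        case True
        then have "card {..<3::nat} \<le> card (R x)"
          using kR fin(2) card_mono by blast
        then show ?thesis
          unfolding A' im using True by (simp add: insert_absorb)
      next
        case notin: False
        have "min 3 (card ?A) \<le> card (R x)"
          using tc[of y x] by (simp add: R_def A)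
        then show ?thesis
          unfolding A' im using False notin fin by simp
      qed
    next
      case notin: False
      have A': "{u \<in> insert v S. l u \<le> y \<and> x \<le> r u} = {u \<in> S. l u \<le> y \<and> x \<le> r u}"
        using notin by auto
      have "(t(v := k)) ` {u \<in> S. l u \<le> y \<and> x \<le> r u} = t ` {u \<in> S. l u \<le> y \<and> x \<le> r u}"
        using False by (intro image_cong) auto
      then show ?thesis
        unfolding A' using tc[of y x] by simp
    qed
    then show ?thesis
      using t k by (intro exI[of _ "t(v := k)"]) simp
  qed
qed

text \<open>The first interval that reaches \<open>a\<close> begins early enough: either it heads
  the list, or it overlaps a predecessor that ends before \<open>a\<close>.\<close>

lemma overlapping_list_meets:
  fixes l r :: "'a \<Rightarrow> real"
  assumes "successively (\<lambda>u v. l u \<le> r v \<and> l v \<le> r u) q" "q \<noteq> []"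
    and "l (hd q) \<le> b" "a \<le> r (last q)" "a \<le> b"
  shows "\<exists>u\<in>set q. l u \<le> b \<and> a \<le> r u"
  using assms
proof (induction q)
  case (Cons w q)
  show ?case
  proof (cases "a \<le> r w")
    case True
    then show ?thesis
      using Cons.prems by auto
  next
    case False
    then have "q \<noteq> []"
      using Cons.prems by auto
    then have "l (hd q) \<le> r w" "successively (\<lambda>u v. l u \<le> r v \<and> l v \<le> r u) q" "a \<le> r (last q)"
      using Cons.prems by (auto simp: successively_Cons)
    then show ?thesis
      using Cons.IH False \<open>q \<noteq> []\<close> \<open>a \<le> b\<close> by force
  qed
qed simp

lemma walk_edges:
  assumes "successively (\<lambda>u v. {u, v} \<in> E) q" "q \<noteq> []"
  shows "\<exists>P\<subseteq>E. finite P \<and> card P < length q \<and> (\<forall>e\<in>P. e \<subseteq> set q) \<and> (\<forall>v\<in>set q. linked P (hd q) v)"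
proof -
  have "\<exists>P\<subseteq>E. finite P \<and> card P < length q \<and> (\<forall>e\<in>P. e \<subseteq> set q) \<and> successively (\<lambda>u v. {u, v} \<in> P) q"
    using assms
  proof (induction q)
    case (Cons a q)
    show ?case
    proof (cases "q = []")
      case True
      then show ?thesis
        by (intro exI[of _ "{}"]) auto
    next
      case False
      then obtain P where P: "P \<subseteq> E" "finite P" "card P < length q" "\<forall>e\<in>P. e \<subseteq> set q"
        "successively (\<lambda>u v. {u, v} \<in> P) q"
        using Cons by (auto simp: successively_Cons)
      have "successively (\<lambda>u v. {u, v} \<in> insert {a, hd q} P) q"
        by (rule successively_mono[OF P(5)]) auto
      moreover have "card (insert {a, hd q} P) \<le> Suc (card P)"
        using P(2) by (simp add: card_insert_if)
      moreover have "{a, hd q} \<in> E" "hd q \<in> set q"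
        using Cons.prems False by (auto simp: successively_Cons)
      ultimately show ?thesis
        using P False by (intro exI[of _ "insert {a, hd q} P"]) (auto simp: successively_Cons)
    qed
  qed simp
  then show ?thesis
    using successively_linked assms(2) by metis
qed

lemma rx3_interval_graph:
  assumes sg: "simple_graph V E" and conn: "connected_graph V E" and deg: "3 \<le> min_degree V E"
    and int: "interval_graph V E"
  shows "rx3 V E \<le> diam V E + 4"
proof -
  have finV: "finite V" and ne: "V \<noteq> {}"
    using sg conn by (auto simp: simple_graph_def connected_graph_def)
  obtain l r :: "'a \<Rightarrow> real" where lr: "\<And>v. v \<in> V \<Longrightarrow> l v \<le> r v"
    and adj: "\<And>u v. u \<in> V \<Longrightarrow> v \<in> V \<Longrightarrow> u \<noteq> v \<Longrightarrow> {u, v} \<in> E \<longleftrightarrow> l u \<le> r v \<and> l v \<le> r u"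
    using interval_graph_real_endpoints[OF int] by metis
  have "Min (r ` V) \<in> r ` V" "Max (l ` V) \<in> l ` V"
    using finV ne by auto
  then obtain a b where a: "a \<in> V" "r a = Min (r ` V)" and b: "b \<in> V" "l b = Max (l ` V)"
    by (metis imageE)
  have first: "r a \<le> r v" and last: "l v \<le> l b" if "v \<in> V" for v
    using a b finV that by auto
  show ?thesis
  proof (cases "l b \<le> r a")
    case True
    \<comment> \<open>Every interval begins by \<open>l b\<close> and ends no earlier than
      \<open>r a\<close>, so any two meet. A complete graph is a threshold graph with constant
      weights, and \<open>5 \<le> diam V E + 4\<close>.\<close>
    have "{u, v} \<in> E" if "u \<in> V" "v \<in> V" "u \<noteq> v" for u v
      using that first[OF that(1)] first[OF that(2)] last[OF that(1)] last[OF that(2)] True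
      by (simp add: adj)
    then have "threshold_graph V E"
      unfolding threshold_graph_def using sg by (intro conjI exI[of _ "\<lambda>_. 0"] exI[of _ 0]) auto
    then have "rx3 V E \<le> 5"
      using rx3_threshold_graph[OF sg deg ne] by blast
    moreover have "1 \<le> diam V E"
    proof -
      have "neighbors E a \<noteq> {}"
        using min_degreeD[OF sg deg a(1)] by auto
      then obtain v where v: "v \<in> V" "a \<noteq> v"
        using edgeD[OF sg] unfolding neighbors_def by blast
      obtain p where p: "walk_between V E a p v" "length p = Suc (distance V E a v)"
        using distance_attained[OF conn a(1) v(1)] .
      have "distance V E a v \<noteq> 0"
      proof
        assume "distance V E a v = 0"
        then have "length p = Suc 0"
          using p(2) by simp
        then show False
          using p(1) v(2) by (auto simp: walk_between_def length_Suc_conv)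
      qed
      then show ?thesis
        using distance_le_diam[OF sg a(1) v(1)] by linarith
    qed
    ultimately show ?thesis
      by linarith
  next
    case False
    have ab: "a \<noteq> b"
      using lr[OF a(1)] False by auto
    then have nadj: "{a, b} \<notin> E"
      using adj[OF a(1) b(1)] False by simp
    obtain p where p: "walk_between V E a p b" "length p = Suc (distance V E a b)"
      using distance_attained[OF conn a(1) b(1)] .
    have "\<exists>q. p = a # q @ [b]"
    proof -
      obtain p' where p': "p = a # p'"
        using p(1) by (cases p) (auto simp: walk_between_def walk_def)
      then have "p' \<noteq> []" "last p' = b"
        using p(1) ab by (auto simp: walk_between_def split: if_splits)
      then show ?thesis
        using p' by (metis append_butlast_last_id)
    qed
    then obtain q where q: "p = a # q @ [b]"
      by blast
    have suc: "successively (\<lambda>u v. {u, v} \<in> E) (a # q @ [b])" and qV: "set q \<subseteq> V"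
      using p(1) unfolding q by (auto simp: walk_between_def walk_def)
    have qne: "q \<noteq> []"
      using suc nadj by auto
    have q_suc: "successively (\<lambda>u v. {u, v} \<in> E) q" and q_first: "{a, hd q} \<in> E" and q_last: "{last q, b} \<in> E"
      using suc qne by (auto simp: successively_Cons successively_append_iff)
    obtain P where P: "P \<subseteq> E" "card P < length q" "\<forall>e\<in>P. e \<subseteq> set q" "\<forall>v\<in>set q. linked P (hd q) v"
      using walk_edges[OF q_suc qne] by blast
    have overlap: "l u \<le> r v \<and> l v \<le> r u" if "{u, v} \<in> E" for u v
      using adj edgeD[OF sg that] that by blast
    have "successively (\<lambda>u v. l u \<le> r v \<and> l v \<le> r u) q"
      by (rule successively_mono[OF q_suc]) (use overlap in auto)
    \<comment> \<open>The interior path starts at an interval meeting \<open>a\<close>, which ends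
      no later than \<open>v\<close>, and stops at one meeting \<open>b\<close>, which begins no
      earlier than \<open>v\<close>. So even without its ends the path dominates.\<close>
    then have meets: "\<exists>u\<in>set q. l u \<le> r v \<and> l v \<le> r u" if "v \<in> V" for v
      using overlapping_list_meets[of l r q "r v" "l v"] qne overlap[OF q_first] overlap[OF q_last]
        first[OF that] last[OF that] lr[OF that] by fastforce
    obtain t :: "'a \<Rightarrow> nat" where t: "\<And>v. t v < 3"
      and tc: "\<And>x y. min 3 (card {u \<in> V - set q. l u \<le> y \<and> x \<le> r u})
        \<le> card (t ` {u \<in> V - set q. l u \<le> y \<and> x \<le> r u})"
      using interval_three_classes[of "V - set q" l r] finV by auto
    have nbrs: "insert v (neighbors E v - set q) = {u \<in> V - set q. l u \<le> r v \<and> l v \<le> r u}"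
      if v: "v \<in> V - set q" for v
    proof -
      have "u \<in> neighbors E v \<longleftrightarrow> u \<in> V \<and> u \<noteq> v \<and> l u \<le> r v \<and> l v \<le> r u" for u
        using adj[of v u] edgeD[OF sg, of v u] v by (auto simp: neighbors_def)
      then show ?thesis
        using v lr[of v] by auto
    qed
    have "rx3 V E \<le> card P + 6"
    proof (rule rx3_dominating[OF sg qV P(1), of "hd q" t])
      show "neighbors E v \<inter> set q \<noteq> {}" if v: "v \<in> V - set q" for v
      proof -
        obtain u where u: "u \<in> set q" "l u \<le> r v" "l v \<le> r u"
          using meets v by auto
        then have "{v, u} \<in> E"
          using adj[of v u] v qV by auto
        then show ?thesis
          using u(1) by (auto simp: neighbors_def)
      qed
      show "min 3 (card (insert v (neighbors E v - set q))) \<le> card (t ` insert v (neighbors E v - set q))"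
        if "v \<in> V - set q" for v
        unfolding nbrs[OF that] by (rule tc)
      show "3 \<le> card (neighbors E v)" if "v \<in> V - set q" for v
        using min_degreeD[OF sg deg] that by blast
    qed (use P t in auto)
    \<comment> \<open>\<open>q\<close> has \<open>distance V E a b - 1\<close> vertices, so
      \<open>P\<close> has at most \<open>distance V E a b - 2\<close> edges.\<close>
    also have "card P + 6 \<le> distance V E a b + 4"
      using P(2) p(2) q by simp
    also have "\<dots> \<le> diam V E + 4"
      using distance_le_diam[OF sg a(1) b(1)] by simp
    finally show ?thesis .
  qed
qed

section \<open>Tightness\<close>

text \<open>Pigeonhole: there are only \<open>card C ^ k\<close> patterns of \<open>k\<close>
  colors, so more than twice as many objects include three with the same pattern.\<close>

lemma three_alike:
  assumes "finite A" "finite C" "2 * card C ^ k < card A" "\<And>a i. a \<in> A \<Longrightarrow> i < k \<Longrightarrow> g a i \<in> C"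
  obtains J where "J \<subseteq> A" "card J = 3" "\<forall>a\<in>J. \<forall>b\<in>J. \<forall>i<k. g a i = g b i"
proof -
  let ?L = "{xs. set xs \<subseteq> C \<and> length xs = k}"
  define f where "f a = map (g a) [0..<k]" for a
  let ?B = "\<lambda>b. {a \<in> A. f a = b}"
  have L: "finite ?L" "card ?L = card C ^ k"
    using assms(2) by (auto simp: finite_lists_length_eq card_lists_length_eq)
  have "f a \<in> ?L" if "a \<in> A" for a
    using assms(4)[OF that] by (auto simp: f_def)
  then have A: "A = (\<Union>b\<in>?L. ?B b)"
    by blast
  have "\<exists>b. 3 \<le> card (?B b)"
  proof (rule ccontr)
    assume "\<nexists>b. 3 \<le> card (?B b)"
    then have "\<not> 3 \<le> card (?B b)" for b
      by blast
    then have "card (?B b) \<le> 2" for b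
      by (simp add: not_le less_Suc_eq_le numeral_3_eq_3 numeral_2_eq_2)
    then have "(\<Sum>b\<in>?L. card (?B b)) \<le> card ?L * 2"
      using sum_bounded_above[of ?L "\<lambda>b. card (?B b)" 2] by simp
    moreover have "card A \<le> (\<Sum>b\<in>?L. card (?B b))"
      using card_UN_le[OF L(1), of ?B] A by simp
    ultimately show False
      using assms(3) L(2) by simp
  qed
  then obtain b J where J: "J \<subseteq> ?B b" "card J = 3"
    by (meson obtain_subset_with_card_n)
  show ?thesis
  proof (rule that)
    show "J \<subseteq> A" "card J = 3"
      using J by auto
    show "\<forall>x\<in>J. \<forall>y\<in>J. \<forall>i<k. g x i = g y i"
    proof (intro ballI allI impI)
      fix x y i
      assume xy: "x \<in> J" "y \<in> J" and i: "i < k"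
      have "f x = f y"
        using J(1) xy by auto
      then have "f x ! i = f y ! i"
        by simp
      then show "g x i = g y i"
        using i by (simp add: f_def)
    qed
  qed
qed

definition graph_edges :: "'a set \<Rightarrow> ('a \<Rightarrow> 'a \<Rightarrow> bool) \<Rightarrow> 'a set set" where
  "graph_edges V R = {{u, v} | u v. u \<in> V \<and> v \<in> V \<and> u \<noteq> v \<and> R u v}"

lemma simple_graph_edges: "finite V \<Longrightarrow> simple_graph V (graph_edges V R)"
  by (auto simp: simple_graph_def graph_edges_def)

lemma mem_graph_edges:
  assumes "\<And>u v. R u v \<Longrightarrow> R v u"
  shows "{u, v} \<in> graph_edges V R \<longleftrightarrow> u \<in> V \<and> v \<in> V \<and> u \<noteq> v \<and> R u v"
  unfolding graph_edges_def by (auto simp: doubleton_eq_iff dest: assms)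

lemma image_eq_of_inj_card:
  assumes "inj_on f A" "f ` A \<subseteq> B" "finite B" "card B \<le> card A"
  shows "f ` A = B"
proof (rule card_seteq[OF assms(3,2)])
  show "card B \<le> card (f ` A)"
    using assms(4) card_image[OF assms(1)] by simp
qed

text \<open>The tree leaves each of the three leaves by an edge to one of 0, 1, 2. For leaves
  colored alike a common end would repeat a color, so the ends differ and all of 0, 1, 2 lie in the
  tree.\<close>

lemma alike_leaves:
  fixes J :: "nat set"
  assumes sg: "simple_graph V E" and col: "three_rainbow_coloring V E c"
    and J: "J \<subseteq> V" "card J = 3" "\<forall>v\<in>J. neighbors E v = {..<3}"
    and alike: "\<forall>u\<in>J. \<forall>v\<in>J. \<forall>i<3. c {u, i} = c {v, i}"
  obtains W F where "simple_graph W F" "F \<subseteq> E" "inj_on c F" "J \<union> {..<3} \<subseteq> W" "card W \<le> card F + 1"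
proof -
  obtain x y z where xyz: "J = {x, y, z}" "x \<noteq> y" "x \<noteq> z" "y \<noteq> z"
    using J(2) unfolding card_3_iff by blast
  then have "x \<in> V" "y \<in> V" "z \<in> V"
    using J(1) by auto
  then show ?thesis
  proof (rule three_rainbow_coloringE[OF col _ _ _ xyz(2-4)])
    fix W F
    assume WF: "simple_graph W F" "W \<subseteq> V" "F \<subseteq> E" "inj_on c F" and W: "x \<in> W" "y \<in> W" "z \<in> W"
      and l: "\<And>u v. u \<in> W \<Longrightarrow> v \<in> W \<Longrightarrow> linked F u v" and card: "card W \<le> card F + 1"
    have JW: "J \<subseteq> W"
      using W xyz(1) by simp
    have "\<exists>i<3. {v, i} \<in> F" if v: "v \<in> J" for v
    proof -
      have "J \<noteq> {v}"
        using J(2) by auto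
      then obtain u where u: "u \<in> J" "u \<noteq> v"
        using v by blast
      then have "linked F v u"
        using l JW v by blast
      then obtain i where i: "{v, i} \<in> F"
        using linked_cross[of F v u "{v}"] u(2) by auto
      then have "i \<in> neighbors E v"
        using WF(3) by (auto simp: neighbors_def)
      then show ?thesis
        using J(3) v i by auto
    qed
    then obtain e where e: "\<And>v. v \<in> J \<Longrightarrow> e v < 3 \<and> {v, e v} \<in> F"
      by metis
    have "inj_on e J"
    proof (rule inj_onI)
      fix u v
      assume uv: "u \<in> J" "v \<in> J" "e u = e v"
      then have "c {u, e u} = c {v, e v}"
        using bspec[OF bspec[OF alike uv(1)] uv(2)] e[OF uv(1)] uv(3) by simp
      then have "{u, e u} = {v, e v}"
        using inj_onD[OF WF(4)] e uv by blast
      then show "u = v"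
        using uv(3) by (auto simp: doubleton_eq_iff)
    qed
    then have "e ` J = {..<3}"
      using e J(2) by (intro image_eq_of_inj_card) auto
    moreover have "e v \<in> W" if "v \<in> J" for v
      using e[OF that] edgeD(2)[OF WF(1)] by blast
    ultimately have "{..<3} \<subseteq> W"
      by (metis image_subsetI)
    then show ?thesis
      by (intro that[OF WF(1,3,4) _ card]) (use JW in blast)
  qed
qed

lemma tight_threshold_graph:
  "\<exists>(V :: nat set) E. simple_graph V E \<and> connected_graph V E \<and> min_degree V E \<ge> 3 \<and>
    threshold_graph V E \<and> rx3 V E = 5"
proof -
  \<comment> \<open>Three universal vertices and \<open>129 = 2 * 4 ^ 3 + 1\<close> leaves, enough
    for three alike under four colors.\<close>
  define V :: "nat set" where "V = {..<132}"
  define E where "E = graph_edges V (\<lambda>u v. u < 3 \<or> v < 3)"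
  have E: "{u, v} \<in> E \<longleftrightarrow> u \<in> V \<and> v \<in> V \<and> u \<noteq> v \<and> (u < 3 \<or> v < 3)" for u v
    unfolding E_def by (rule mem_graph_edges) auto
  have V0: "0 \<in> V"
    by (simp add: V_def)
  have sg: "simple_graph V E"
    unfolding E_def by (rule simple_graph_edges) (simp add: V_def)
  have conn: "connected_graph V E"
  proof (rule connected_graph_rootI[OF sg])
    show "linked E 0 v" if "v \<in> V" for v
    proof (cases "v = 0")
      case False
      then show ?thesis
        using that by (intro linked_edge) (simp add: E, simp add: V_def)
    qed simp
  qed (simp add: V_def)
  have deg: "3 \<le> min_degree V E"
  proof (rule min_degreeI[OF sg])
    fix v
    assume v: "v \<in> V"
    let ?S = "if v < 3 then {0, 1, 2, 3} - {v} else {0, 1, 2}"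
    have "card ?S \<le> card (neighbors E v)"
    proof (rule card_mono[OF finite_neighbors[OF sg]])
      show "?S \<subseteq> neighbors E v"
        using v by (auto simp: neighbors_def E) (simp_all add: V_def)
    qed
    moreover have "3 \<le> card ?S"
      by (simp add: card_Diff_singleton_if)
    ultimately show "3 \<le> card (neighbors E v)"
      by linarith
  qed (use V0 in blast)
  have th: "threshold_graph V E"
    unfolding threshold_graph_def
    using sg by (intro conjI exI[of _ "\<lambda>u. if u < 3 then 1 else 0"] exI[of _ 1]) (auto simp: E)
  have "5 \<le> rx3 V E"
  proof (rule ccontr)
    assume less: "\<not> 5 \<le> rx3 V E"
    obtain c where c: "three_rainbow_coloring V E c" "card (c ` E) = rx3 V E"
      using rx3_attained[OF sg conn] .
    then have cE: "card (c ` E) \<le> 4"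
      using less by simp
    then have "card (c ` E) ^ 3 \<le> 4 ^ 3"
      by (rule power_mono) simp
    then have big: "2 * card (c ` E) ^ 3 < card {3..<132::nat}"
      by simp
    have mem: "c {v, i} \<in> c ` E" if "v \<in> {3..<132}" "i < 3" for v i
      using that by (intro imageI) (simp add: E, simp add: V_def)
    obtain J where J: "J \<subseteq> {3..<132}" "card J = 3"
      "\<forall>u\<in>J. \<forall>v\<in>J. \<forall>i<3. c {u, i} = c {v, i}"
      using three_alike[of "{3..<132}" "c ` E" 3 "\<lambda>v i. c {v, i}", OF _ _ big mem]
        simple_graph_finite_edges[OF sg] by auto
    have nbr: "\<forall>v\<in>J. neighbors E v = {..<3}"
      using J(1) by (force simp: neighbors_def E V_def)
    have JV: "J \<subseteq> V"
      using J(1) by (auto simp: V_def)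
    obtain W F where WF: "simple_graph W F" "F \<subseteq> E" "inj_on c F" "J \<union> {..<3} \<subseteq> W"
      "card W \<le> card F + 1"
      using alike_leaves[OF sg c(1) JV J(2) nbr J(3)] by blast
    have "finite J"
      using J(1) finite_subset by blast
    then have "card (J \<union> {..<3}) = 6"
      using J(1,2) by (subst card_Un_disjoint) auto
    moreover have "card (J \<union> {..<3}) \<le> card W"
      using WF(1,4) by (auto simp: simple_graph_def intro: card_mono)
    \<comment> \<open>Six vertices in the tree require five edges of different colors.\<close>
    ultimately show False
      using WF(5) card_rainbow_le[OF sg WF(2,3)] cE by linarith
  qed
  moreover have "rx3 V E \<le> 5"
    using rx3_threshold_graph[OF sg deg _ th] V0 by blast
  ultimately have "rx3 V E = 5"
    by simp
  then show ?thesis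
    using sg conn deg th by blast
qed

lemma tight_chain_graph:
  "\<exists>(V :: nat set) E. simple_graph V E \<and> connected_graph V E \<and> min_degree V E \<ge> 3 \<and>
    chain_graph V E \<and> rx3 V E = 6"
proof -
  \<comment> \<open>\<open>254 = 3 + (2 * 5 ^ 3 + 1)\<close>, for three alike vertices under five
    colors.\<close>
  define V :: "nat set" where "V = {..<254}"
  define E where "E = graph_edges V (\<lambda>u v. u < 3 \<longleftrightarrow> \<not> v < 3)"
  have E: "{u, v} \<in> E \<longleftrightarrow> u \<in> V \<and> v \<in> V \<and> (u < 3 \<longleftrightarrow> \<not> v < 3)" for u v
    unfolding E_def by (subst mem_graph_edges) auto
  have sg: "simple_graph V E"
    unfolding E_def by (rule simple_graph_edges) (simp add: V_def)
  have inV: "v \<in> V" if "v < 254" for v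
    using that by (simp add: V_def)
  have conn: "connected_graph V E"
  proof (rule connected_graph_rootI[OF sg])
    show "linked E 0 v" if "v \<in> V" for v
    proof (cases "v < 3")
      case True
      then have "{0, 3} \<in> E" "{3, v} \<in> E"
        using that inV by (simp_all add: E)
      then show ?thesis
        by (meson linked_edge linked_trans)
    next
      case False
      then show ?thesis
        using that inV by (intro linked_edge) (simp add: E)
    qed
  qed (simp add: inV)
  have nbr: "neighbors E v = {..<3}" if "v \<in> V" "\<not> v < 3" for v
    using that by (auto simp: neighbors_def E inV)
  have nbr': "neighbors E v = {3..<254}" if "v \<in> V" "v < 3" for v
    using that by (auto simp: neighbors_def E) (simp_all add: V_def)
  have deg: "3 \<le> min_degree V E"
  proof (rule min_degreeI[OF sg])
    show "3 \<le> card (neighbors E v)" if "v \<in> V" for v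
      using nbr[OF that] nbr'[OF that] by (cases "v < 3") auto
  qed (use inV[of 0] in auto)
  have "bipartition V E {..<3} {3..<254}"
    unfolding bipartition_def
  proof (intro conjI ballI)
    fix e
    assume e: "e \<in> E"
    obtain u v where uv: "e = {u, v}" "u \<in> V" "v \<in> V"
      using edgeE[OF sg e] by metis
    then have "u < 3 \<longleftrightarrow> \<not> v < 3"
      using e by (simp add: E)
    then have "u \<in> {..<3} \<and> v \<in> {3..<254} \<or> v \<in> {..<3} \<and> u \<in> {3..<254}"
      using uv by (auto simp: V_def)
    then show "\<exists>a\<in>{..<3}. \<exists>b\<in>{3..<254}. e = {a, b}"
      using uv(1) insert_commute[of u v "{}"] by blast
  qed (auto simp: V_def)
  moreover have "sorted_wrt (\<lambda>a a'. neighbors E a \<subseteq> neighbors E a') [0, 1, 2]"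
    using nbr'[of 0] nbr'[of 1] nbr'[of 2] inV by simp
  moreover have "set [0, 1, 2] = {..<3::nat}"
    by auto
  moreover have "distinct [0, 1, 2::nat]"
    by simp
  ultimately have ch: "chain_graph V E"
    unfolding chain_graph_def using sg by blast
  have "6 \<le> rx3 V E"
  proof (rule ccontr)
    assume less: "\<not> 6 \<le> rx3 V E"
    obtain c where c: "three_rainbow_coloring V E c" "card (c ` E) = rx3 V E"
      using rx3_attained[OF sg conn] .
    then have cE: "card (c ` E) \<le> 5"
      using less by simp
    then have "card (c ` E) ^ 3 \<le> 5 ^ 3"
      by (rule power_mono) simp
    then have big: "2 * card (c ` E) ^ 3 < card {3..<254::nat}"
      by simp
    have mem: "c {v, i} \<in> c ` E" if "v \<in> {3..<254}" "i < 3" for v i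
      using that inV by (intro imageI) (simp add: E)
    obtain J where J: "J \<subseteq> {3..<254}" "card J = 3"
      "\<forall>u\<in>J. \<forall>v\<in>J. \<forall>i<3. c {u, i} = c {v, i}"
      using three_alike[of "{3..<254}" "c ` E" 3 "\<lambda>v i. c {v, i}", OF _ _ big mem]
        simple_graph_finite_edges[OF sg] by auto
    have nbrJ: "\<forall>v\<in>J. neighbors E v = {..<3}"
      using J(1) inV by (intro ballI nbr) auto
    have JV: "J \<subseteq> V"
      using J(1) inV by auto
    obtain W F where WF: "simple_graph W F" "F \<subseteq> E" "inj_on c F" "J \<union> {..<3} \<subseteq> W"
      "card W \<le> card F + 1"
      using alike_leaves[OF sg c(1) JV J(2) nbrJ J(3)] by blast
    have finJ: "finite J"
      using J(1) finite_subset by blast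
    have card6: "card (J \<union> {..<3}) = 6"
      using J(1,2) finJ by (subst card_Un_disjoint) auto
    have finW: "finite W"
      using WF(1) by (simp add: simple_graph_def)
    \<comment> \<open>Six vertices give only five edges, so a seventh is needed. The edges between
      \<open>J\<close> and \<open>{..<3}\<close> show just three colors, too few for a tree on these
      six vertices alone.\<close>
    have "W \<noteq> J \<union> {..<3}"
    proof
      assume W: "W = J \<union> {..<3}"
      obtain x where x: "x \<in> J"
        using J(2) by fastforce
      have "c ` F \<subseteq> (\<lambda>i. c {x, i}) ` {..<3}"
      proof
        fix k
        assume "k \<in> c ` F"
        then obtain e where e: "e \<in> F" "k = c e"
          by blast
        obtain u v where uv: "e = {u, v}" "u \<in> W" "v \<in> W"
          using edgeE[OF WF(1) e(1)] by metis
        then have "{u, v} \<in> E"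
          using e(1) WF(2) by blast
        then have one: "u < 3 \<longleftrightarrow> \<not> v < 3"
          by (simp add: E)
        have "\<exists>w\<in>J. \<exists>i<3. e = {w, i}"
        proof (cases "u < 3")
          case True
          then show ?thesis
            using one uv W by (metis UnE insert_commute lessThan_iff)
        next
          case False
          then show ?thesis
            using one uv W by (metis UnE lessThan_iff)
        qed
        then obtain w i where wi: "w \<in> J" "i < 3" "e = {w, i}"
          by blast
        then have "k = c {x, i}"
          using J(3) x e(2) by blast
        then show "k \<in> (\<lambda>i. c {x, i}) ` {..<3}"
          using wi(2) by simp
      qed
      then have "card (c ` F) \<le> card {..<3::nat}"
        by (meson card_image_le card_mono finite_imageI finite_lessThan le_trans)
      then show False
        using WF(5) card6 W card_image[OF WF(3)] by simp
    qed
    then have "card (J \<union> {..<3}) < card W"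
      using WF(4) finW by (intro psubset_card_mono) auto
    then show False
      using card6 WF(5) card_rainbow_le[OF sg WF(2,3)] cE by linarith
  qed
  moreover have "V \<noteq> {}"
    using inV[of 0] by auto
  then have "rx3 V E \<le> 6"
    using rx3_chain_graph[OF sg deg _ ch] by blast
  ultimately have "rx3 V E = 6"
    by simp
  then show ?thesis
    using sg conn deg ch by blast
qed

text \<open>
  The windmill of \<open>m\<close> copies of \<open>K\<^sub>4\<close> that share the vertex \<open>3 * m\<close>. If three blades \<open>j \<in> J\<close> are
  colored alike, then a rainbow tree for their \<open>i\<close>-th vertices leaves the blades through edges to
  the center of all three colors \<open>p k\<close>, and two of the \<open>i\<close>-th vertices are left by different
  edges of the blade.
\<close>

definition windmill :: "nat \<Rightarrow> nat set set" where
  "windmill m = graph_edges {..<3 * m + 1} (\<lambda>u v. u div 3 = v div 3 \<or> u = 3 * m \<or> v = 3 * m)"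

lemma mem_windmill:
  "{u, v} \<in> windmill m \<longleftrightarrow> u \<le> 3 * m \<and> v \<le> 3 * m \<and> u \<noteq> v \<and>
    (u div 3 = v div 3 \<or> u = 3 * m \<or> v = 3 * m)"
  unfolding windmill_def by (subst mem_graph_edges) auto

lemma simple_windmill: "simple_graph {..<3 * m + 1} (windmill m)"
  unfolding windmill_def by (rule simple_graph_edges) simp

lemma blade_vertex_eq: "k < 3 \<Longrightarrow> k' < 3 \<Longrightarrow> 3 * j + k = 3 * j' + k' \<longleftrightarrow> j = j' \<and> k = (k' :: nat)"
  by presburger

lemma blade_vertex_less: "j < m \<Longrightarrow> k < 3 \<Longrightarrow> 3 * j + k < 3 * (m :: nat)"
  by presburger

text \<open>For use with \<open>i\<close> = 0, 1, 2 in turn: the tree for the \<open>i\<close>-th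
  vertices shows the three center colors and the two blade colors at \<open>i\<close>, so these five
  differ.\<close>

lemma windmill_alike_blades:
  assumes col: "three_rainbow_coloring {..<3 * m + 1} (windmill m) c"
    and J: "J \<subseteq> {..<m}" "card J = 3" and i: "i < 3"
    and p: "\<forall>j\<in>J. \<forall>k<3. c {3 * j + k, 3 * m} = p k"
    and q: "\<forall>j\<in>J. \<forall>k<3. k \<noteq> i \<longrightarrow> c {3 * j + i, 3 * j + k} = q k"
  shows "inj_on p {..<3}" "inj_on q ({..<3} - {i})" "p ` {..<3} \<inter> q ` ({..<3} - {i}) = {}"
proof -
  let ?V = "{..<3 * m + 1}"
  obtain x y z where xyz: "J = {x, y, z}" "x \<noteq> y" "x \<noteq> z" "y \<noteq> z"
    using J(2) unfolding card_3_iff by blast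
  have finJ: "finite J"
    using J(1) finite_subset by blast
  have Jm: "j < m" if "j \<in> J" for j
    using J(1) that by auto
  have jV: "3 * j + k \<in> ?V" if "j \<in> J" "k < 3" for j k
    using blade_vertex_less[OF Jm[OF that(1)] that(2)] by simp
  have "3 * x + i \<in> ?V" "3 * y + i \<in> ?V" "3 * z + i \<in> ?V"
    using jV[OF _ i] xyz(1) by simp_all
  moreover have "3 * x + i \<noteq> 3 * y + i" "3 * x + i \<noteq> 3 * z + i" "3 * y + i \<noteq> 3 * z + i"
    using xyz(2-4) by simp_all
  ultimately obtain W F where FE: "F \<subseteq> windmill m" and inj: "inj_on c F"
    and W: "3 * x + i \<in> W" "3 * y + i \<in> W" "3 * z + i \<in> W"
    and l: "\<forall>u\<in>W. \<forall>v\<in>W. linked F u v"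
    using three_rainbow_coloringE[OF col] by metis
  have JW: "3 * j + i \<in> W" if "j \<in> J" for j
    using that W xyz(1) by auto
  have other: "\<exists>j'\<in>J. j' \<noteq> j" for j
    using xyz by auto
  have "\<exists>k<3. {3 * j + k, 3 * m} \<in> F" if j: "j \<in> J" for j
  proof -
    let ?X = "{v. v div 3 = j}"
    obtain j' where j': "j' \<in> J" "j' \<noteq> j"
      using other by blast
    have "linked F (3 * j + i) (3 * j' + i)"
      using l JW j j'(1) by blast
    moreover have "3 * j + i \<in> ?X" "3 * j' + i \<notin> ?X"
      using i j'(2) by simp_all
    ultimately obtain a b where ab: "a div 3 = j" "b div 3 \<noteq> j" "{a, b} \<in> F"
      using linked_cross[of F "3 * j + i" "3 * j' + i" ?X] by blast
    have "{a, b} \<in> windmill m"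
      using FE ab(3) by blast
    then have "a div 3 = b div 3 \<or> a = 3 * m \<or> b = 3 * m"
      unfolding mem_windmill by blast
    moreover have "a \<noteq> 3 * m"
      using ab(1) Jm[OF j] by auto
    ultimately have "b = 3 * m"
      using ab(1,2) by auto
    moreover have "a = 3 * j + a mod 3"
      using ab(1) by auto
    ultimately show ?thesis
      using ab(3) by (metis mod_less_divisor zero_less_numeral)
  qed
  then obtain s where s: "\<And>j. j \<in> J \<Longrightarrow> s j < 3" "\<And>j. j \<in> J \<Longrightarrow> {3 * j + s j, 3 * m} \<in> F"
    by metis
  \<comment> \<open>Two blades left at the same position would repeat a center color.\<close>
  have s_inj: "inj_on s J"
  proof (rule inj_onI)
    fix j j'
    assume jj': "j \<in> J" "j' \<in> J" "s j = s j'"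
    then have "c {3 * j + s j, 3 * m} = c {3 * j' + s j', 3 * m}"
      using p s(1) by simp
    then have "{3 * j + s j, 3 * m} = {3 * j' + s j', 3 * m}"
      using inj_onD[OF inj] s(2) jj'(1,2) by blast
    moreover have "3 * j + s j \<noteq> 3 * m"
      using blade_vertex_less[OF Jm s(1)] jj'(1) by fastforce
    ultimately have "3 * j + s j = 3 * j' + s j'"
      by (auto simp: doubleton_eq_iff)
    then show "j = j'"
      using jj'(3) by simp
  qed
  have s_onto: "s ` J = {..<3}"
    using s(1) J(2) by (intro image_eq_of_inj_card[OF s_inj]) auto
  have P: "\<exists>j\<in>J. {3 * j + k, 3 * m} \<in> F" if "k < 3" for k
  proof -
    have "k \<in> s ` J"
      using s_onto that by simp
    then obtain j where "j \<in> J" "s j = k"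
      by blast
    then show ?thesis
      using s(2) by blast
  qed
  \<comment> \<open>The blades whose chosen exit is not the \<open>i\<close>-th vertex; there this
    vertex needs an edge inside the blade.\<close>
  define J' where "J' = {j \<in> J. s j \<noteq> i}"
  have "\<exists>k. k < 3 \<and> k \<noteq> i \<and> {3 * j + i, 3 * j + k} \<in> F" if j: "j \<in> J'" for j
  proof -
    have jJ: "j \<in> J" "s j \<noteq> i"
      using j by (auto simp: J'_def)
    obtain j' where j': "j' \<in> J" "j' \<noteq> j"
      using other by blast
    have "linked F (3 * j + i) (3 * j' + i)"
      using l JW jJ(1) j'(1) by blast
    moreover have "3 * j' + i \<noteq> 3 * j + i"
      using j'(2) by simp
    ultimately obtain b where b: "{3 * j + i, b} \<in> F"
      using linked_cross[of F "3 * j + i" "3 * j' + i" "{3 * j + i}"] by auto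
    have "{3 * j + i, b} \<in> windmill m"
      using FE b by blast
    moreover have "3 * j + i \<noteq> 3 * m"
      using blade_vertex_less[OF Jm[OF jJ(1)] i] by simp
    \<comment> \<open>Another blade already has its center edge at position \<open>i\<close> in the
      tree, and this edge would repeat its color.\<close>
    moreover have "b \<noteq> 3 * m"
    proof
      assume bm: "b = 3 * m"
      have "i \<in> s ` J"
        using s_onto i by simp
      then obtain j'' where j'': "j'' \<in> J" "s j'' = i"
        by blast
      then have "c {3 * j + i, 3 * m} = c {3 * j'' + i, 3 * m}"
        using p i jJ(1) by simp
      then have "{3 * j + i, 3 * m} = {3 * j'' + i, 3 * m}"
        using inj_onD[OF inj] s(2)[OF j''(1)] b bm j''(2) by blast
      then have "j = j''"
        using \<open>3 * j + i \<noteq> 3 * m\<close> by (auto simp: doubleton_eq_iff)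
      then show False
        using j''(2) jJ(2) by simp
    qed
    ultimately have "b div 3 = (3 * j + i) div 3" "b \<noteq> 3 * j + i"
      unfolding mem_windmill by auto
    then have "b = 3 * j + b mod 3" "b mod 3 \<noteq> i"
      using i by auto
    then show ?thesis
      using b by (metis mod_less_divisor zero_less_numeral)
  qed
  then obtain t where t: "\<And>j. j \<in> J' \<Longrightarrow> t j < 3" "\<And>j. j \<in> J' \<Longrightarrow> t j \<noteq> i"
    "\<And>j. j \<in> J' \<Longrightarrow> {3 * j + i, 3 * j + t j} \<in> F"
    by metis
  have t_inj: "inj_on t J'"
  proof (rule inj_onI)
    fix j j'
    assume jj': "j \<in> J'" "j' \<in> J'" "t j = t j'"
    then have J: "j \<in> J" "j' \<in> J"
      by (auto simp: J'_def)
    then have "c {3 * j + i, 3 * j + t j} = c {3 * j' + i, 3 * j' + t j'}"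
      using q t jj' by simp
    then have eq: "{3 * j + i, 3 * j + t j} = {3 * j' + i, 3 * j' + t j'}"
      using inj_onD[OF inj] t(3) jj'(1,2) by blast
    have "(\<lambda>v. v div 3) ` {3 * j + i, 3 * j + t j} = {j}" "(\<lambda>v. v div 3) ` {3 * j' + i, 3 * j' + t j'} = {j'}"
      using i t(1)[OF jj'(1)] t(1)[OF jj'(2)] by simp_all
    then show "j = j'"
      using eq by simp
  qed
  have "s ` J' = {..<3} - {i}"
    using s_onto by (auto simp: J'_def)
  then have "card J' = card ({..<3} - {i})"
    using card_image[OF inj_on_subset[OF s_inj, of J']] by (auto simp: J'_def)
  then have t_onto: "t ` J' = {..<3} - {i}"
    using t(1,2) by (intro image_eq_of_inj_card[OF t_inj]) auto
  have Q: "\<exists>j\<in>J. {3 * j + i, 3 * j + k} \<in> F" if "k < 3" "k \<noteq> i" for k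
  proof -
    have "k \<in> t ` J'"
      using t_onto that by simp
    then obtain j where "j \<in> J'" "t j = k"
      by blast
    then show ?thesis
      using t(3) by (auto simp: J'_def)
  qed
  show "inj_on p {..<3}"
  proof (rule inj_onI)
    fix k k'
    assume k: "k \<in> {..<3}" "k' \<in> {..<3}" "p k = p k'"
    obtain j j' where j: "j \<in> J" "{3 * j + k, 3 * m} \<in> F" and j': "j' \<in> J" "{3 * j' + k', 3 * m} \<in> F"
      using P k(1,2) by (meson lessThan_iff)
    then have "c {3 * j + k, 3 * m} = c {3 * j' + k', 3 * m}"
      using p k by simp
    then have "{3 * j + k, 3 * m} = {3 * j' + k', 3 * m}"
      using inj_onD[OF inj] j(2) j'(2) by blast
    moreover have "3 * j + k \<noteq> 3 * m"
      using blade_vertex_less[OF Jm[OF j(1)]] k(1) by fastforce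
    ultimately have "3 * j + k = 3 * j' + k'"
      by (auto simp: doubleton_eq_iff)
    then show "k = k'"
      using blade_vertex_eq k(1,2) by (metis lessThan_iff)
  qed
  show "inj_on q ({..<3} - {i})"
  proof (rule inj_onI)
    fix k k'
    assume k: "k \<in> {..<3} - {i}" "k' \<in> {..<3} - {i}" "q k = q k'"
    obtain j j' where j: "j \<in> J" "{3 * j + i, 3 * j + k} \<in> F"
      and j': "j' \<in> J" "{3 * j' + i, 3 * j' + k'} \<in> F"
      using Q[of k] Q[of k'] k(1,2) by auto
    then have "c {3 * j + i, 3 * j + k} = c {3 * j' + i, 3 * j' + k'}"
      using q k by simp
    then have "{3 * j + i, 3 * j + k} = {3 * j' + i, 3 * j' + k'}"
      using inj_onD[OF inj] j(2) j'(2) by blast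
    then have "(\<lambda>v. v mod 3) ` {3 * j + i, 3 * j + k} = (\<lambda>v. v mod 3) ` {3 * j' + i, 3 * j' + k'}"
      by simp
    then have "{i, k} = {i, k'}"
      using i k(1,2) by simp
    then show "k = k'"
      by (auto simp: doubleton_eq_iff)
  qed
  show "p ` {..<3} \<inter> q ` ({..<3} - {i}) = {}"
  proof (rule ccontr)
    assume "\<not> ?thesis"
    then obtain k k' where k: "k < 3" "k' < 3" "k' \<noteq> i" "p k = q k'"
      by auto
    obtain j j' where j: "j \<in> J" "{3 * j + k, 3 * m} \<in> F"
      and j': "j' \<in> J" "{3 * j' + i, 3 * j' + k'} \<in> F"
      using P[OF k(1)] Q[OF k(2,3)] by blast
    then have "c {3 * j + k, 3 * m} = c {3 * j' + i, 3 * j' + k'}"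
      using p q k by simp
    then have "{3 * j + k, 3 * m} = {3 * j' + i, 3 * j' + k'}"
      using inj_onD[OF inj] j(2) j'(2) by blast
    then have "3 * m \<in> {3 * j' + i, 3 * j' + k'}"
      by blast
    then show False
      using blade_vertex_less[OF Jm[OF j'(1)] i] blade_vertex_less[OF Jm[OF j'(1)] k(2)] by auto
  qed
qed

text \<open>Any two of the six edge colors of a repeated blade pattern are separated by one of the
  three choices of \<open>i\<close>. With at most five colors such a pattern exists, which is
  impossible.\<close>

lemma windmill_colors:
  assumes col: "three_rainbow_coloring {..<3 * m + 1} (windmill m) c" and m: "2 * 5 ^ 6 < m"
  shows "6 \<le> card (c ` windmill m)"
proof (rule ccontr)
  let ?C = "c ` windmill m"
  have finC: "finite ?C"
    using simple_graph_finite_edges[OF simple_windmill] by blast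
  assume "\<not> 6 \<le> card ?C"
  then have "card ?C ^ 6 \<le> 5 ^ 6"
    by (intro power_mono) auto
  then have big: "2 * card ?C ^ 6 < card {..<m}"
    using m by simp
  \<comment> \<open>The color pattern of blade \<open>j\<close>: three edges to the center, then the
    three edges of its triangle. This is the exponent 6 in \<open>2 * 5 ^ 6\<close>.\<close>
  define g where "g j = (!) [c {3 * j + 0, 3 * m}, c {3 * j + 1, 3 * m}, c {3 * j + 2, 3 * m},
    c {3 * j + 0, 3 * j + 1}, c {3 * j + 0, 3 * j + 2}, c {3 * j + 1, 3 * j + 2}]" for j
  have edges: "c {3 * j + k, 3 * m} \<in> ?C" "k \<noteq> k' \<Longrightarrow> c {3 * j + k, 3 * j + k'} \<in> ?C"
    if "j < m" "k < 3" "k' < 3" for j k k'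
    using that blade_vertex_less[OF that(1,2)] blade_vertex_less[OF that(1,3)]
    by (auto simp: mem_windmill)
  have six: "(\<forall>n<6. P n) \<longleftrightarrow> P 0 \<and> P 1 \<and> P 2 \<and> P 3 \<and> P 4 \<and> P 5" for P :: "nat \<Rightarrow> bool"
    by (simp add: numeral_eq_Suc All_less_Suc conj_ac)
  have "\<forall>n<6. g j n \<in> ?C" if "j < m" for j
    unfolding six g_def
    using edges(1)[OF that, of 0 0] edges(1)[OF that, of 1 0] edges(1)[OF that, of 2 0]
      edges(2)[OF that, of 0 1] edges(2)[OF that, of 0 2] edges(2)[OF that, of 1 2]
    by simp
  then have mem: "g j n \<in> ?C" if "j \<in> {..<m}" "n < 6" for j n
    using that by blast
  obtain J where J: "J \<subseteq> {..<m}" "card J = 3" and alike: "\<forall>a\<in>J. \<forall>b\<in>J. \<forall>n<6. g a n = g b n"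
    using three_alike[of "{..<m}" ?C 6 g, OF _ finC big mem] by auto
  obtain a where a: "a \<in> J"
    using J(2) by fastforce
  define p where "p k = c {3 * a + k, 3 * m}" for k
  define q where "q i k = c {3 * a + i, 3 * a + k}" for i k
  have q_sym: "q i k = q k i" for i k
    by (simp add: q_def insert_commute)
  have same: "c {3 * j + 0, 3 * m} = p 0 \<and> c {3 * j + 1, 3 * m} = p 1 \<and> c {3 * j + 2, 3 * m} = p 2 \<and>
    c {3 * j + 0, 3 * j + 1} = q 0 1 \<and> c {3 * j + 0, 3 * j + 2} = q 0 2 \<and>
    c {3 * j + 1, 3 * j + 2} = q 1 2" if "j \<in> J" for j
  proof -
    have "\<forall>n<6. g j n = g a n"
      using alike that a by blast
    then show ?thesis
      unfolding six by (simp add: g_def p_def q_def)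
  qed
  have three: "k = 0 \<or> k = 1 \<or> k = 2" if "k < 3" for k :: nat
    using that by linarith
  have same_p: "\<forall>j\<in>J. \<forall>k<3. c {3 * j + k, 3 * m} = p k"
    using same three by metis
  have same_q: "\<forall>j\<in>J. \<forall>k<3. k \<noteq> i \<longrightarrow> c {3 * j + i, 3 * j + k} = q i k" if "i < 3" for i
  proof (intro ballI allI impI)
    fix j k :: nat
    assume j: "j \<in> J" and k: "k < 3" "k \<noteq> i"
    show "c {3 * j + i, 3 * j + k} = q i k"
      using three[OF \<open>i < 3\<close>] three[OF k(1)] k(2) same[OF j]
      by (elim disjE) (simp_all add: insert_commute q_sym)
  qed
  note blades = windmill_alike_blades[OF col J _ same_p same_q]
  have sets: "{..<3} = {0, 1, 2::nat}" "{..<3} - {0} = {1, 2::nat}" "{..<3} - {1} = {0, 2::nat}"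
    "{..<3} - {2} = {0, 1::nat}"
    by auto
  have "p 0 \<noteq> p 1" "p 0 \<noteq> p 2" "p 1 \<noteq> p 2"
    using blades(1)[of 0] by (auto simp: sets(1))
  moreover have "q 0 1 \<noteq> q 0 2" "{p 0, p 1, p 2} \<inter> {q 0 1, q 0 2} = {}"
    using blades(2,3)[of 0, unfolded sets(2), unfolded sets(1)] by simp_all
  moreover have "q 0 1 \<noteq> q 1 2" "{p 0, p 1, p 2} \<inter> {q 0 1, q 1 2} = {}"
    using blades(2,3)[of 1, unfolded sets(3), unfolded sets(1)] by (simp_all add: q_sym[of "Suc 0" 0])
  moreover have "q 0 2 \<noteq> q 1 2"
    using blades(2)[of 2, unfolded sets(4)] by (simp add: q_sym[of 2 0] q_sym[of 2 "Suc 0"])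
  ultimately have "card {p 0, p 1, p 2, q 0 1, q 0 2, q 1 2} = 6"
    by auto
  moreover have "{p 0, p 1, p 2, q 0 1, q 0 2, q 1 2} \<subseteq> ?C"
  proof -
    have "a < m"
      using a J(1) by auto
    then show ?thesis
      using edges(1)[of a 0 0] edges(1)[of a 1 0] edges(1)[of a 2 0]
        edges(2)[of a 0 1] edges(2)[of a 0 2] edges(2)[of a 1 2]
      by (simp add: p_def q_def)
  qed
  ultimately show False
    using card_mono[OF finC, of "{p 0, p 1, p 2, q 0 1, q 0 2, q 1 2}"] \<open>\<not> 6 \<le> card ?C\<close> by simp
qed

lemma tight_interval_graph:
  "\<exists>(V :: nat set) E. simple_graph V E \<and> connected_graph V E \<and> min_degree V E \<ge> 3 \<and>
    interval_graph V E \<and> rx3 V E = diam V E + 4"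
proof -
  define m :: nat where "m = 2 * 5 ^ 6 + 1"
  define V where "V = {..<3 * m + 1}"
  define E where "E = windmill m"
  have m: "2 * 5 ^ 6 < m" "0 < m"
    by (simp_all add: m_def)
  have sg: "simple_graph V E"
    unfolding V_def E_def by (rule simple_windmill)
  have E: "{u, v} \<in> E \<longleftrightarrow> u \<in> V \<and> v \<in> V \<and> u \<noteq> v \<and> (u div 3 = v div 3 \<or> u = 3 * m \<or> v = 3 * m)" for u v
    unfolding E_def V_def mem_windmill by auto
  have center: "3 * m \<in> V"
    by (simp add: V_def)
  have star: "{3 * m, v} \<in> E" if "v \<in> V" "v \<noteq> 3 * m" for v
    using that center by (simp add: E)
  have conn: "connected_graph V E"
  proof (rule connected_graph_rootI[OF sg center])
    show "linked E (3 * m) v" if "v \<in> V" for v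
      using star[OF that] by (cases "v = 3 * m") (auto intro: linked_edge)
  qed
  have deg: "3 \<le> min_degree V E"
  proof (rule min_degreeI[OF sg])
    fix v
    assume v: "v \<in> V"
    let ?S = "if v = 3 * m then {0, 1, 2} else {3 * m} \<union> ({3 * (v div 3), 3 * (v div 3) + 1, 3 * (v div 3) + 2} - {v})"
    have "?S \<subseteq> neighbors E v"
    proof (cases "v = 3 * m")
      case True
      then show ?thesis
        using center m(2) by (auto simp: neighbors_def E V_def)
    next
      case False
      then have "v < 3 * m"
        using v by (simp add: V_def)
      then have "3 * (v div 3) + 2 < 3 * m"
        by presburger
      then show ?thesis
        using False v by (auto simp: neighbors_def E V_def)
    qed
    moreover have "card ?S = 3"
    proof (cases "v = 3 * m")
      case False
      then have "v < 3 * m"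
        using v by (simp add: V_def)
      define j where "j = v div 3"
      have "j < m"
        using \<open>v < 3 * m\<close> by (simp add: j_def)
      have "v = 3 * j \<or> v = 3 * j + 1 \<or> v = 3 * j + 2"
        unfolding j_def by presburger
      then show ?thesis
        using False \<open>j < m\<close> unfolding j_def[symmetric] by (elim disjE) (auto simp: insert_Diff_if)
    qed simp
    ultimately show "3 \<le> card (neighbors E v)"
      using card_mono[OF finite_neighbors[OF sg], of ?S v] by simp
  qed (use center in blast)
  have int: "interval_graph V E"
  proof -
    \<comment> \<open>The center is the whole line, and each blade a single point shared by its
      three vertices.\<close>
    let ?I = "\<lambda>v. if v = 3 * m then UNIV else {real (v div 3)}"
    have "\<forall>v\<in>V. is_interval (?I v) \<and> ?I v \<noteq> {}"
      by (simp add: is_interval_1)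
    moreover have "\<forall>u\<in>V. \<forall>v\<in>V. u \<noteq> v \<longrightarrow> ({u, v} \<in> E \<longleftrightarrow> ?I u \<inter> ?I v \<noteq> {})"
      by (simp add: E)
    ultimately show ?thesis
      unfolding interval_graph_def using sg by (intro conjI exI[of _ ?I])
  qed
  have "distance V E u v \<le> 2" if uv: "u \<in> V" "v \<in> V" for u v
  proof -
    have "\<exists>p. walk_between V E u p v \<and> length p \<le> Suc 2"
    proof -
      consider "u = v" | "{u, v} \<in> E" | "{u, 3 * m} \<in> E" "{3 * m, v} \<in> E"
        using star[OF uv(1)] star[OF uv(2)] by (metis insert_commute)
      then show ?thesis
      proof cases
        case 1
        then show ?thesis
          using walk_between_single[OF uv(1)] by (intro exI[of _ "[u]"]) simp
      next
        case 2
        then show ?thesis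
          using uv by (intro exI[of _ "[u, v]"]) (simp add: walk_between_def walk_def)
      next
        case 3
        then show ?thesis
          using uv center by (intro exI[of _ "[u, 3 * m, v]"]) (simp add: walk_between_def walk_def)
      qed
    qed
    then show ?thesis
      by (elim exE conjE) (rule distance_le)
  qed
  \<comment> \<open>This and \<open>6 \<le> rx3 V E\<close> leave no room in the general bound
    \<open>rx3 V E \<le> diam V E + 4\<close>.\<close>
  then have "diam V E \<le> 2"
    using diam_attained[OF sg] center by (metis empty_iff)
  moreover have "6 \<le> rx3 V E"
    using rx3_attained[OF sg conn] windmill_colors[OF _ m(1)] unfolding V_def E_def by metis
  moreover have "rx3 V E \<le> diam V E + 4"
    using rx3_interval_graph[OF sg conn deg int] .
  ultimately have "rx3 V E = diam V E + 4"
    by linarith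
  then show ?thesis
    using sg conn deg int by blast
qed

theorem corollary10:
  "(\<forall>(V :: 'a set) E. simple_graph V E \<and> connected_graph V E \<and> min_degree V E \<ge> 3 \<longrightarrow>
      (threshold_graph V E \<longrightarrow> rx3 V E \<le> 5) \<and>
      (chain_graph V E \<longrightarrow> rx3 V E \<le> 6) \<and>
      (interval_graph V E \<longrightarrow> diam V E \<le> rx3 V E \<and> rx3 V E \<le> diam V E + 4)) \<and>
   (\<exists>(V :: nat set) E. simple_graph V E \<and> connected_graph V E \<and> min_degree V E \<ge> 3 \<and>
      threshold_graph V E \<and> rx3 V E = 5) \<and>
   (\<exists>(V :: nat set) E. simple_graph V E \<and> connected_graph V E \<and> min_degree V E \<ge> 3 \<and>
      chain_graph V E \<and> rx3 V E = 6) \<and>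
   (\<exists>(V :: nat set) E. simple_graph V E \<and> connected_graph V E \<and> min_degree V E \<ge> 3 \<and>
      interval_graph V E \<and> rx3 V E = diam V E + 4)"
proof (intro conjI allI impI)
  fix V :: "'a set" and E
  assume asm: "simple_graph V E \<and> connected_graph V E \<and> 3 \<le> min_degree V E"
  then have G: "simple_graph V E" "connected_graph V E" "3 \<le> min_degree V E" "V \<noteq> {}"
    by (auto simp: connected_graph_def)
  show "rx3 V E \<le> 5" if "threshold_graph V E"
    using rx3_threshold_graph[OF G(1,3,4) that] .
  show "rx3 V E \<le> 6" if "chain_graph V E"
    using rx3_chain_graph[OF G(1,3,4) that] .
  show "diam V E \<le> rx3 V E"
    using diam_le_rx3[OF G(1-3)] .
  show "rx3 V E \<le> diam V E + 4" if "interval_graph V E"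
    using rx3_interval_graph[OF G(1-3) that] .
qed (fact tight_threshold_graph tight_chain_graph tight_interval_graph)+

end
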